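(* Consider the reach-avoid game described in the context, with speed ratio $\alpha=v_E/v_P\in(0,1)$. Assume all players have pairwise distinct initial positions, the pursuers' initial positions lie in $\Omega$, the evaders' initial positions lie in $\Omega_{\rm play}$, and no virtual pursuer coincides with a pursuer other than its own original. Given the initial positions of all pursuers and evaders, the number $q$ of evaders which the pursuit team can guarantee to prevent from reaching $\Omega_{\rm tar}$ (in the sense of pursuer-evader matching defined in the context) is $$q=\max\ \bm c^{\mathsf T}\bm z\quad\text{s.t.}\quad A_1\bm z\le\bm b_1,\ A_2\bm z\le\bm b_2,\ A_3\bm z\le\bm b_3,\quad \bm z=[\bm s^1,\bm s^2]^{\mathsf T}\in\{0,1\}^{N_v},$$ and a maximum matching is given by $\bm z^*=\arg\max_{\bm z}\bm c^{\mathsf T}\bm z$ over this feasible set. Here $N_v=N_eN_p(N_p+1)/2$, inequalities are componentwise, $$\bm c={\rm ones}(N_v,1),\quad A_1=I_{N_v},\quad \bm b_1=\bm r^{\mathsf T},\quad A_2={\rm ones}(1,N_v/N_e)\otimes I_{N_e},\quad \bm b_2={\rm ones}(N_e,1),\quad \bm b_3={\rm ones}(N_p,1),$$ $\bm r$ is the prior information vector, and $A_3=[\,I_{N_p}\otimes{\rm ones}(1,N_e),\ C\otimes{\rm ones}(1,N_e)\,]$, where $C$ is the $N_p\times N_p(N_p-1)/2$ matrix (absent if $N_p=1$) whose entry $C_{ij}$ is $1$ if $j=i-k+(k-1)(N_p-k/2)$ for some $k\in\{1,\dots,i-1\}$, or if $(i-1)(N_p-i/2)+1\le j\le i(N_p-(i+1)/2)$,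 and is $0$ otherwise.
   Context: Domain. $\Omega\subset\mathbb R^2$ is a bounded convex domain. A straight segment $\mathcal T\subset\Omega$ (the target line) with endpoints $\bm m=(0,0)$ and $\bm n=(l,0)$, $l>0$, both on $\partial\Omega$, cuts $\Omega$ into the compact target region $\Omega_{\rm tar}\supset\mathcal T$ (the part in $y\ge 0$) and the play region $\Omega_{\rm play}=\Omega\setminus\Omega_{\rm tar}$ (the part in $y<0$). Players. There are pursuers $P_1,\dots,P_{N_p}$ and evaders $E_1,\dots,E_{N_e}$, which are points moving in $\Omega$ with $\dot{\mathbf x}_{P_i}=v_P\mathbf u_{P_i}$, $\dot{\mathbf x}_{E_j}=v_E\mathbf u_{E_j}$, controls in $\mathcal U=\{\mathbf u\in\mathbb R^2:\|\mathbf u\|_2=1\}$, and initial positions $\mathbf x^0_{P_i},\mathbf x^0_{E_j}$; $\alpha=v_E/v_P$. An evader is captured when its position in $\Omega_{\rm play}$ coincides with that of a pursuer; once it enters $\Omega_{\rm tar}$ it can no longer be captured. Information structure: the evader uses state feedback; the pursuit team uses state feedback together with the evader's current input (non-anticipative strategies). For a pursuer with $\mathbf x^0_{P_i}=(x^0_{P_i},y^0_{P_i})\in\Omega_{\rm tar}$, its virtual pursuer has initial position $(x^0_{P_i},-y^0_{P_i})$. Winning regions and barrier. A pursuit coalition $k$ is a nonempty set of $n_k$ pursuers with joint initial position $\mathcal X_k^0$. For a game between coalition $k$ and one evader: $\mathcal W_P^{n_k}(\mathcal X_k^0)\subset\Omega_{\rm play}$ is the set of initial evader positions from which the coalition can guarantee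 capture before the evader enters $\Omega_{\rm tar}$, whatever the evader does; $\mathcal W_E^{n_k}(\mathcal X_k^0)\subset\Omega_{\rm play}$ is the set of initial evader positions from which the evader can guarantee entering $\Omega_{\rm tar}$ without being captured, whatever the coalition does. The barrier $\mathcal B^{n_k}(\mathcal X_k^0)$ separates these two regions (on it, under optimal play, capture and arrival at $\mathcal T$ happen simultaneously), and $\mathcal B^{n_k}\cup\mathcal W_P^{n_k}\cup\mathcal W_E^{n_k}=\Omega_{\rm play}$. Matching and the number $q$. Consider the bipartite graph whose nodes are, on one side, all $2^{N_p}-1$ pursuit coalitions and, on the other, all $N_e$ evaders; coalition $k$ is joined to $E_j$ iff $k$ can guarantee the capture of $E_j$ in $\Omega_{\rm play}$ or on $\mathcal T$, i.e. iff $\mathbf x^0_{E_j}\notin\mathcal W_E^{n_k}(\mathcal X_k^0)$. A matching is a set of edges with no two sharing a node and such that every pursuer belongs to at most one of the coalitions used. The number of evaders which the pursuit team can guarantee to prevent from reaching $\Omega_{\rm tar}$ is the maximum number of edges of such a matching; a matching attaining it is a maximum matching. Prior information vector. For $P_i$, $\bm r_i^1=[r_i^1(1),\dots,r_i^1(N_e)]$ with $r_i^1(j)=0$ if $\mathbf x^0_{E_j}\in\mathcal W_E^1(\mathbf x^0_{P_i})$ and $r_i^1(j)=1$ otherwise. For a pair $i1<i2$, $\bm r^2_{i1,i2}=[r^2_{i1,i2}(1),\dots,r^2_{i1,i2}(N_e)]$ with $r^2_{i1,i2}(j)=0$ if $\mathbf x^0_{E_j}\in\mathcal W_E^2(\{\mathbf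 x^0_{P_{i1}},\mathbf x^0_{P_{i2}}\})$ and $1$ otherwise. Then $\bm r=[\bm r_1^1,\dots,\bm r_{N_p}^1,\bm r_{1,2}^2,\dots,\bm r_{1,N_p}^2,\bm r_{2,3}^2,\dots,\bm r_{N_p-1,N_p}^2]\in\mathbb R^{N_v}$ (pairs in lexicographic order). Strategy vectors. $\bm s^1=[\bm s_1^1,\dots,\bm s_{N_p}^1]$ and $\bm s^2=[\bm s_{1,2}^2,\dots,\bm s_{1,N_p}^2,\bm s_{2,3}^2,\dots,\bm s_{N_p-1,N_p}^2]$ with blocks in $\{0,1\}^{N_e}$, where $s_i^1(j)=1$ means $P_i$ alone is assigned to $E_j$ and $s^2_{i1,i2}(j)=1$ means the pair $\{P_{i1},P_{i2}\}$ is assigned to $E_j$ (so $\bm z$ encodes assignments using only one- and two-pursuer coalitions). Notation: ${\rm ones}(m,n)$ is the $m\times n$ all-ones matrix, $I_n$ the identity matrix, $\otimes$ the Kronecker product. *)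

theory Defs
  imports "HOL-Analysis.Analysis" "Jordan_Normal_Form.Matrix"
begin

unbundle no vec_syntax
unbundle no inner_syntax

section \<open>The reach-avoid game\<close>

type_synonym plane = "real \<times> real"

definition target_region :: "plane set \<Rightarrow> plane set" where
  "target_region \<Omega> = {x \<in> \<Omega>. snd x \<ge> 0}"

definition play_region :: "plane set \<Rightarrow> plane set" where
  "play_region \<Omega> = \<Omega> - target_region \<Omega>"

definition target_line :: "real \<Rightarrow> plane set" where
  "target_line l = closed_segment (0, 0) (l, 0)"

text \<open>\<open>\<Omega>\<close> is not required to be open or closed: it contains the end points of the target line,
  which are boundary points, its part in the upper half plane is compact, and nothing is said about
  the boundary of the play region. That the target line cuts \<open>\<Omega>\<close> means that it is the whole
  intersection of \<open>\<Omega>\<close> with the \<open>x\<close>-axis.\<close>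

definition game_domain :: "plane set \<Rightarrow> real \<Rightarrow> bool" where
  "game_domain \<Omega> l \<longleftrightarrow>
     l > 0 \<and> bounded \<Omega> \<and> convex \<Omega> \<and> interior \<Omega> \<noteq> {} \<and>
     (0, 0) \<in> frontier \<Omega> \<and> (l, 0) \<in> frontier \<Omega> \<and>
     {x \<in> \<Omega>. snd x = 0} = target_line l \<and>
     compact (target_region \<Omega>)"

definition virtual_pursuer :: "plane \<Rightarrow> plane" where
  "virtual_pursuer x = (fst x, - snd x)"

text \<open>The solution of \<open>x' = v u\<close>, \<open>x(0) = x0\<close>.\<close>

definition position :: "real \<Rightarrow> plane \<Rightarrow> (real \<Rightarrow> plane) \<Rightarrow> real \<Rightarrow> plane" where
  "position v x0 u t = x0 + v *\<^sub>R integral {0..t} u"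

definition controls :: "plane set \<Rightarrow> real \<Rightarrow> plane \<Rightarrow> (real \<Rightarrow> plane) set" where
  "controls \<Omega> v x0 = {u \<in> borel_measurable (lebesgue_on {0..}).
     (\<forall>t\<ge>0. norm (u t) = 1) \<and> (\<forall>t\<ge>0. position v x0 u t \<in> \<Omega>)}"

text \<open>A strategy of the coalition \<open>K\<close> with initial positions \<open>X\<close> against an evader starting at \<open>y\<close>
  turns the evader's control into controls of the pursuers. It may use everything up to and
  including the evader's current input, and nothing later.\<close>

definition nonanticipative ::
  "plane set \<Rightarrow> real \<Rightarrow> real \<Rightarrow> (nat \<Rightarrow> plane) \<Rightarrow> nat set \<Rightarrow> plane \<Rightarrow>
   ((real \<Rightarrow> plane) \<Rightarrow> nat \<Rightarrow> real \<Rightarrow> plane) \<Rightarrow> bool" where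
  "nonanticipative \<Omega> vP vE X K y \<gamma> \<longleftrightarrow>
     (\<forall>u \<in> controls \<Omega> vE y. \<forall>i\<in>K. \<gamma> u i \<in> controls \<Omega> vP (X i)) \<and>
     (\<forall>u \<in> controls \<Omega> vE y. \<forall>u' \<in> controls \<Omega> vE y. \<forall>t\<ge>0.
        (AE s in lebesgue_on {0..t}. u s = u' s) \<longrightarrow>
        (\<forall>i\<in>K. AE s in lebesgue_on {0..t}. \<gamma> u i s = \<gamma> u' i s))"

text \<open>Trajectories \<open>e\<close> of the evader and \<open>p i\<close> of the pursuers \<open>i \<in> K\<close>: up to and including time
  \<open>t\<close>, the evader has neither left the play region nor been captured.\<close>

definition ongoing ::
  "plane set \<Rightarrow> nat set \<Rightarrow> (real \<Rightarrow> plane) \<Rightarrow> (nat \<Rightarrow> real \<Rightarrow> plane) \<Rightarrow> real \<Rightarrow> bool" where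
  "ongoing \<Omega> K e p t \<longleftrightarrow> (\<forall>s\<in>{0..t}. e s \<in> play_region \<Omega> \<and> (\<forall>i\<in>K. e s \<noteq> p i s))"

text \<open>A pursuer meeting the evader at the very moment when the evader arrives at the target line
  counts as a capture (on the target line). Hence, with \<open>t\<close> the time of arrival, meeting at time \<open>t\<close>
  is excluded as well; this is what keeps the barrier out of the evader's winning region.\<close>

definition evader_wins ::
  "plane set \<Rightarrow> nat set \<Rightarrow> (real \<Rightarrow> plane) \<Rightarrow> (nat \<Rightarrow> real \<Rightarrow> plane) \<Rightarrow> bool" where
  "evader_wins \<Omega> K e p \<longleftrightarrow>
     (\<exists>t\<ge>0. e t \<in> target_region \<Omega> \<and> (\<forall>s\<in>{0..<t}. e s \<in> play_region \<Omega>) \<and>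
        (\<forall>s\<in>{0..t}. \<forall>i\<in>K. e s \<noteq> p i s))"

text \<open>\<open>play \<Omega> vP vE X K y \<phi> \<gamma> u\<close>: the evader control \<open>u\<close> results from the evader using the state
  feedback law \<open>\<phi>\<close> against the pursuit strategy \<open>\<gamma>\<close>. The law has to be followed only until the
  game ends; what the players do afterwards is irrelevant.\<close>

definition play ::
  "plane set \<Rightarrow> real \<Rightarrow> real \<Rightarrow> (nat \<Rightarrow> plane) \<Rightarrow> nat set \<Rightarrow> plane \<Rightarrow>
   (plane \<Rightarrow> (nat \<Rightarrow> plane) \<Rightarrow> plane) \<Rightarrow> ((real \<Rightarrow> plane) \<Rightarrow> nat \<Rightarrow> real \<Rightarrow> plane) \<Rightarrow>
   (real \<Rightarrow> plane) \<Rightarrow> bool" where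
  "play \<Omega> vP vE X K y \<phi> \<gamma> u \<longleftrightarrow>
     u \<in> controls \<Omega> vE y \<and>
     (let e = position vE y u; p = (\<lambda>i. position vP (X i) (\<gamma> u i)) in
        AE t in lebesgue_on {0..}.
          ongoing \<Omega> K e p t \<longrightarrow> u t = \<phi> (e t) (\<lambda>i\<in>K. p i t))"

text \<open>The evader's winning region against the coalition \<open>K\<close>. A feedback law is arbitrary, in
  particular it may be discontinuous. It guarantees success only if, against every pursuit strategy,
  the closed loop has a solution and all its solutions are won by the evader; without the
  requirement of existence a law admitting no trajectory at all would win vacuously.\<close>

definition evader_region ::
  "plane set \<Rightarrow> real \<Rightarrow> real \<Rightarrow> (nat \<Rightarrow> plane) \<Rightarrow> nat set \<Rightarrow> plane set" where
  "evader_region \<Omega> vP vE X K = {y \<in> play_region \<Omega>.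
     \<exists>\<phi>. (\<forall>x P. norm (\<phi> x P) = 1) \<and>
       (\<forall>\<gamma>. nonanticipative \<Omega> vP vE X K y \<gamma> \<longrightarrow>
          (\<exists>u. play \<Omega> vP vE X K y \<phi> \<gamma> u) \<and>
          (\<forall>u. play \<Omega> vP vE X K y \<phi> \<gamma> u \<longrightarrow>
             evader_wins \<Omega> K (position vE y u) (\<lambda>i. position vP (X i) (\<gamma> u i))))}"


section \<open>Matchings between pursuit coalitions and evaders\<close>

text \<open>The pursuers are \<open>1, \<dots>, Np\<close> with initial positions \<open>XP\<close>, the evaders \<open>1, \<dots>, Ne\<close> with initial
  positions \<open>XE\<close>. An edge is a pair of a coalition and an evader.\<close>

definition capture_edges ::
  "plane set \<Rightarrow> real \<Rightarrow> real \<Rightarrow> nat \<Rightarrow> nat \<Rightarrow> (nat \<Rightarrow> plane) \<Rightarrow> (nat \<Rightarrow> plane) \<Rightarrow>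
   (nat set \<times> nat) set" where
  "capture_edges \<Omega> vP vE Np Ne XP XE =
     {(K, j). K \<subseteq> {1..Np} \<and> K \<noteq> {} \<and> j \<in> {1..Ne} \<and> XE j \<notin> evader_region \<Omega> vP vE XP K}"

definition is_matching :: "(nat set \<times> nat) set \<Rightarrow> (nat set \<times> nat) set \<Rightarrow> bool" where
  "is_matching G M \<longleftrightarrow> M \<subseteq> G \<and>
     (\<forall>(K, j)\<in>M. \<forall>(K', j')\<in>M. (K, j) \<noteq> (K', j') \<longrightarrow> K \<noteq> K' \<and> j \<noteq> j' \<and> K \<inter> K' = {})"

definition matching_number :: "(nat set \<times> nat) set \<Rightarrow> nat" where
  "matching_number G = Max (card ` {M. is_matching G M})"

definition is_maximum_matching :: "(nat set \<times> nat) set \<Rightarrow> (nat set \<times> nat) set \<Rightarrow> bool" where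
  "is_maximum_matching G M \<longleftrightarrow> is_matching G M \<and> card M = matching_number G"


section \<open>The integer program\<close>

definition ones :: "nat \<Rightarrow> nat \<Rightarrow> real mat" where
  "ones m n = mat m n (\<lambda>_. 1)"

definition ones_vec :: "nat \<Rightarrow> real Matrix.vec" where
  "ones_vec n = Matrix.vec n (\<lambda>_. 1)"

definition kronecker :: "real mat \<Rightarrow> real mat \<Rightarrow> real mat" (infixl "\<otimes>\<^sub>K" 70) where
  "A \<otimes>\<^sub>K B = mat (dim_row A * dim_row B) (dim_col A * dim_col B)
     (\<lambda>(i, j). A $$ (i div dim_row B, j div dim_col B) * B $$ (i mod dim_row B, j mod dim_col B))"

definition append_cols :: "real mat \<Rightarrow> real mat \<Rightarrow> real mat" (infixr "@\<^sub>c" 65) where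
  "A @\<^sub>c B = four_block_mat A B (0\<^sub>m 0 (dim_col A)) (0\<^sub>m 0 (dim_col B))"

text \<open>The blocks of the strategy vector and of the prior information vector, in order: singletons,
  then pairs lexicographically. Block number \<open>b\<close>, evader \<open>j\<close> is the entry \<open>b * Ne + (j - 1)\<close>,
  since blocks and vector entries are counted from 0 and evaders from 1.\<close>

definition small_coalitions :: "nat \<Rightarrow> nat set list" where
  "small_coalitions Np =
     map (\<lambda>i. {i}) [1..<Np + 1] @
     concat (map (\<lambda>i1. map (\<lambda>i2. {i1, i2}) [i1 + 1..<Np + 1]) [1..<Np + 1])"

definition prior_information ::
  "plane set \<Rightarrow> real \<Rightarrow> real \<Rightarrow> nat \<Rightarrow> nat \<Rightarrow> (nat \<Rightarrow> plane) \<Rightarrow> (nat \<Rightarrow> plane) \<Rightarrow>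
   real Matrix.vec" where
  "prior_information \<Omega> vP vE Np Ne XP XE = vec_of_list (concat (map
     (\<lambda>K. map (\<lambda>j. if XE j \<in> evader_region \<Omega> vP vE XP K then 0 else 1) [1..<Ne + 1])
     (small_coalitions Np)))"

definition assignment :: "nat \<Rightarrow> nat \<Rightarrow> real Matrix.vec \<Rightarrow> (nat set \<times> nat) set" where
  "assignment Np Ne z =
     {(small_coalitions Np ! b, j) | b j.
        b < length (small_coalitions Np) \<and> j \<in> {1..Ne} \<and> z $ (b * Ne + (j - 1)) = 1}"

definition num_vars :: "nat \<Rightarrow> nat \<Rightarrow> nat" where
  "num_vars Np Ne = Ne * Np * (Np + 1) div 2"

text \<open>The entry in row \<open>i\<close>, column \<open>j\<close>, counted from 1. The formulas contain halves and are therefore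
  evaluated in the reals.\<close>

definition C_entry :: "nat \<Rightarrow> nat \<Rightarrow> nat \<Rightarrow> real" where
  "C_entry Np i j =
     (if (\<exists>k\<in>{1..<i}. real j = real i - real k + (real k - 1) * (real Np - real k / 2)) \<or>
         (real i - 1) * (real Np - real i / 2) + 1 \<le> real j \<and>
         real j \<le> real i * (real Np - (real i + 1) / 2)
      then 1 else 0)"

definition C_mat :: "nat \<Rightarrow> real mat" where
  "C_mat Np = mat Np (Np * (Np - 1) div 2) (\<lambda>(i, j). C_entry Np (i + 1) (j + 1))"

definition A1_mat :: "nat \<Rightarrow> nat \<Rightarrow> real mat" where
  "A1_mat Np Ne = 1\<^sub>m (num_vars Np Ne)"

definition A2_mat :: "nat \<Rightarrow> nat \<Rightarrow> real mat" where
  "A2_mat Np Ne = ones 1 (num_vars Np Ne div Ne) \<otimes>\<^sub>K 1\<^sub>m Ne"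

definition A3_mat :: "nat \<Rightarrow> nat \<Rightarrow> real mat" where
  "A3_mat Np Ne = (1\<^sub>m Np \<otimes>\<^sub>K ones 1 Ne) @\<^sub>c (C_mat Np \<otimes>\<^sub>K ones 1 Ne)"

definition feasible :: "nat \<Rightarrow> nat \<Rightarrow> real Matrix.vec \<Rightarrow> real Matrix.vec set" where
  "feasible Np Ne r = {z \<in> carrier_vec (num_vars Np Ne).
     (\<forall>i < num_vars Np Ne. z $ i \<in> {0, 1}) \<and>
     A1_mat Np Ne *\<^sub>v z \<le> r \<and>
     A2_mat Np Ne *\<^sub>v z \<le> ones_vec Ne \<and>
     A3_mat Np Ne *\<^sub>v z \<le> ones_vec Np}"

end

theory Submission
  imports Defs
begin

text \<open>The evader beats a coalition iff some point of the target line is strictly closer to it than to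
  every pursuer, in time. Running straight to such a point is enough. Conversely suppose that every
  point \<open>x\<close> of the target line is guarded by one of two pursuers \<open>P\<^sub>1, P\<^sub>2\<close>, i.e.
  \<open>\<alpha> |x - P\<^sub>i| \<le> |x - y|\<close> for some \<open>i\<close>. Both pursuers run straight to the minimiser \<open>q\<close> of
  \<open>max\<^sub>i (|x - y|\<^sup>2 - \<alpha>\<^sup>2 |x - P\<^sub>i|\<^sup>2)\<close> over the target line. The maximum exceeds its minimum by at least
  \<open>(1 - \<alpha>\<^sup>2) |x - q|\<^sup>2\<close>, and this outweighs the detour a pursuer makes by running to \<open>q\<close> instead of \<open>x\<close>, so the line
  stays guarded for a time proportional to the distance of the evader from the line, whatever the
  evader does. Repeating such steps, the line is still guarded in the limit, when the evader
  arrives, and hence the evader is caught there.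

  The points of the line that the evader reaches before a given pursuer form an interval. By
  Helly's theorem on the line, a coalition that can guarantee capture therefore contains one or two
  pursuers that can do so on their own, and coalitions in a matching may be shrunk to these. The
  integer program encodes the matchings of coalitions of at most two pursuers.\<close>

section \<open>Guarding the target line during one step\<close>

text \<open>Both quadratics have the same leading coefficient, so along a chord each of them, and
  hence their maximum, lies below the chord by at least \<open>\<epsilon> * (1 - \<epsilon>) *
  (\<kappa> * (x - x0)\<^sup>2)\<close>. If the growth bound failed at \<open>x\<close>, a short
  move from the minimiser towards \<open>x\<close> would decrease the maximum.\<close>

lemma max_quadratic_growth:
  fixes b1 b2 c1 c2 \<kappa> l :: real
  defines "f1 \<equiv> \<lambda>x. \<kappa> * x\<^sup>2 + b1 * x + c1" and "f2 \<equiv> \<lambda>x. \<kappa> * x\<^sup>2 + b2 * x + c2"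
  assumes "l \<ge> 0"
  obtains x0 where "x0 \<in> {0..l}"
    "\<And>x. x \<in> {0..l} \<Longrightarrow>
       max (f1 x) (f2 x) \<ge> max (f1 x0) (f2 x0) + \<kappa> * (x - x0)\<^sup>2"
proof -
  define f where "f x = max (f1 x) (f2 x)" for x
  have "continuous_on {0..l} f"
    unfolding f_def f1_def f2_def by (intro continuous_intros)
  then obtain x0 where x0: "x0 \<in> {0..l}" "\<And>x. x \<in> {0..l} \<Longrightarrow> f x0 \<le> f x"
    using continuous_attains_inf[of "{0..l}" f] assms by auto
  have "f x \<ge> f x0 + \<kappa> * (x - x0)\<^sup>2" if x: "x \<in> {0..l}" for x
  proof (rule ccontr)
    assume less: "\<not> ?thesis"
    define \<delta> where "\<delta> = f x0 + \<kappa> * (x - x0)\<^sup>2 - f x"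
    have \<delta>: "\<delta> > 0" using less by (simp add: \<delta>_def)
    \<comment> \<open>So small that the quadratic term scaled by \<epsilon> stays below the defect
      \<delta>; the absolute value and the 1 keep the denominator positive whatever \<kappa> and
      \<open>x\<close> are.\<close>
    define \<epsilon> where "\<epsilon> = min 1 (\<delta> / (2 * (\<bar>\<kappa> * (x - x0)\<^sup>2\<bar> + 1)))"
    have \<epsilon>: "0 < \<epsilon>" "\<epsilon> \<le> 1" using \<delta> by (auto simp: \<epsilon>_def)
    have "\<epsilon> * (\<kappa> * (x - x0)\<^sup>2) \<le> \<epsilon> * (\<bar>\<kappa> * (x - x0)\<^sup>2\<bar> + 1)"
      using \<epsilon> by (intro mult_left_mono) auto
    also have "\<dots> \<le> \<delta> / (2 * (\<bar>\<kappa> * (x - x0)\<^sup>2\<bar> + 1)) * (\<bar>\<kappa> * (x - x0)\<^sup>2\<bar> + 1)"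
      by (intro mult_right_mono) (auto simp: \<epsilon>_def)
    also have "\<dots> = \<delta> / 2" by (simp add: field_simps)
    also have "\<dots> < \<delta>" using \<delta> by simp
    finally have small: "\<epsilon> * (\<kappa> * (x - x0)\<^sup>2) < \<delta>" .
    define z where "z = (1 - \<epsilon>) * x0 + \<epsilon> * x"
    have "z \<in> {0..l}"
    proof -
      have "z \<le> (1 - \<epsilon>) * l + \<epsilon> * l" unfolding z_def
        using x0(1) x \<epsilon> by (intro add_mono mult_left_mono) auto
      moreover have "z \<ge> 0" unfolding z_def using x0(1) x \<epsilon> by auto
      ultimately show ?thesis by (simp add: algebra_simps)
    qed
    have chord: "\<kappa> * z\<^sup>2 + b * z + c =
        (1 - \<epsilon>) * (\<kappa> * x0\<^sup>2 + b * x0 + c) + \<epsilon> * (\<kappa> * x\<^sup>2 + b * x + c) - \<epsilon> * (1 - \<epsilon>) * (\<kappa> * (x - x0)\<^sup>2)" for b c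
      unfolding z_def by (simp add: algebra_simps power2_eq_square)
    have bound: "f x0 > (1 - \<epsilon>) * u + \<epsilon> * w - \<epsilon> * (1 - \<epsilon>) * (\<kappa> * (x - x0)\<^sup>2)"
      if "u \<le> f x0" "w \<le> f x" for u w
    proof -
      have "(1 - \<epsilon>) * u + \<epsilon> * w \<le> (1 - \<epsilon>) * f x0 + \<epsilon> * f x"
        using that \<epsilon> by (intro add_mono mult_left_mono) auto
      also have "\<dots> = f x0 + \<epsilon> * (\<kappa> * (x - x0)\<^sup>2) - \<epsilon> * \<delta>"
        by (simp add: \<delta>_def algebra_simps)
      moreover have "\<epsilon> * (\<epsilon> * (\<kappa> * (x - x0)\<^sup>2)) < \<epsilon> * \<delta>"
        using small \<epsilon> by simp
      ultimately show ?thesis by (simp add: algebra_simps)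
    qed
    have "f1 z < f x0" "f2 z < f x0"
      unfolding f1_def f2_def chord by (rule bound; simp add: f_def f1_def f2_def)+
    then have "f z < f x0" by (simp add: f_def)
    with x0(2)[OF \<open>z \<in> {0..l}\<close>] show False by simp
  qed
  then show ?thesis using x0(1) that unfolding f_def by blast
qed

text \<open>Stewart's theorem for a point on the line through \<open>P\<close> and \<open>q\<close>.
  It measures a pursuer's run towards its goal and, later, convex combinations along the target
  line.\<close>

lemma dist_moved_point_sq:
  fixes P q p :: "'a::real_inner"
  shows "(dist p ((1 - \<mu>) *\<^sub>R P + \<mu> *\<^sub>R q))\<^sup>2 =
    (1 - \<mu>) * (dist p P)\<^sup>2 + \<mu> * (dist p q)\<^sup>2 - \<mu> * (1 - \<mu>) * (dist q P)\<^sup>2"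
  by (simp add: dist_norm power2_norm_eq_inner inner_simps algebra_simps inner_commute)

text \<open>\<open>A\<close> stands for the evader's distance to \<open>p\<close>, rescaled by the
  speed ratio, and \<open>A\<^sup>2 - (dist p P)\<^sup>2\<close> is the pursuer's surplus at
  \<open>p\<close>. During a step of length \<rho> the evader may reduce \<open>A\<close> by \<rho>.
  Half of the surplus pays for this, the other half for the detour caused by running to
  \<open>q\<close> instead of \<open>p\<close>.\<close>

lemma dist_after_approach:
  fixes P q p :: "'a::real_inner"
  assumes "(dist p P)\<^sup>2 + k * (dist p q)\<^sup>2 \<le> A\<^sup>2" and "A > 0" and "k \<ge> 0"
    and "0 \<le> \<rho>" "\<rho> \<le> A / 4" "\<rho> \<le> k * dist q P / 2" "\<rho> \<le> dist q P" "P \<noteq> q"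
  shows "dist p (P + \<rho> *\<^sub>R sgn (q - P)) + \<rho> \<le> A"
proof -
  define b where "b = dist q P"
  define B where "B = dist p P"
  define h where "h = dist p q"
  define \<mu> where "\<mu> = \<rho> / b"
  define E where "E = A\<^sup>2 - B\<^sup>2"
  have b: "b > 0" using assms by (simp add: b_def)
  have E: "k * h\<^sup>2 \<le> E" using assms(1) by (simp add: E_def B_def h_def)
  have "0 \<le> k * h\<^sup>2" using \<open>k \<ge> 0\<close> by simp
  with E have E0: "0 \<le> E" by linarith
  have B: "0 \<le> B" by (simp add: B_def)
  have "P + \<rho> *\<^sub>R sgn (q - P) = (1 - \<mu>) *\<^sub>R P + \<mu> *\<^sub>R q"
    by (simp add: \<mu>_def b_def sgn_div_norm dist_norm algebra_simps divide_inverse)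
  then have eq: "(dist p (P + \<rho> *\<^sub>R sgn (q - P)))\<^sup>2 = (1 - \<mu>) * B\<^sup>2 + \<mu> * h\<^sup>2 - \<mu> * (1 - \<mu>) * b\<^sup>2"
    by (simp add: dist_moved_point_sq B_def h_def b_def)
  have \<rho>: "\<rho> = \<mu> * b" using b by (simp add: \<mu>_def)
  have \<mu>0: "\<mu> \<ge> 0" using b assms by (simp add: \<mu>_def)
  have gap: "(A - B) * A \<le> E"
  proof -
    have "(A - B) * A \<le> (A - B) * (A + B)"
    proof (rule mult_left_mono)
      show "0 \<le> A - B" using E0 B \<open>A > 0\<close> power2_le_imp_le[of B A] by (simp add: E_def)
    qed (use B in simp)
    then show ?thesis by (simp add: E_def algebra_simps power2_eq_square)
  qed
  have "2 * \<rho> * (A - B) \<le> E / 2"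
  proof -
    have "A - B \<ge> 0" using E0 B \<open>A > 0\<close> power2_le_imp_le[of B A] by (simp add: E_def)
    then have "\<rho> * (A - B) \<le> A / 4 * (A - B)" using assms by (intro mult_right_mono) auto
    then show ?thesis using gap by (simp add: algebra_simps)
  qed
  moreover have "\<mu> * h\<^sup>2 \<le> E / 2"
  proof -
    have "\<mu> \<le> k / 2" using assms b by (simp add: \<mu>_def b_def field_simps)
    then have "\<mu> * h\<^sup>2 \<le> k / 2 * h\<^sup>2" by (intro mult_right_mono) auto
    with E show ?thesis by simp
  qed
  moreover have "0 \<le> \<mu> * (B - b)\<^sup>2" using \<mu>0 by simp
  \<comment> \<open>Right side minus left side equals \<open>E - 2 * \<rho> * (A - B) - \<mu> *
    h\<^sup>2 + \<mu> * (B - b)\<^sup>2\<close>, which the three collected facts make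
    nonnegative.\<close>
  ultimately have "(1 - \<mu>) * B\<^sup>2 + \<mu> * h\<^sup>2 - \<mu> * (1 - \<mu>) * b\<^sup>2 \<le> (A - \<rho>)\<^sup>2"
    unfolding E_def \<rho> by (simp add: algebra_simps power2_eq_square)
  then have "dist p (P + \<rho> *\<^sub>R sgn (q - P)) \<le> A - \<rho>"
    unfolding eq[symmetric] by (rule power2_le_imp_le) (use assms in simp)
  then show ?thesis by simp
qed

text \<open>For a pursuer already close to \<open>q\<close> the direction of the step is arbitrary:
  the move and the elapsed time together cost at most \<open>2 * (\<alpha> * \<rho>)\<close>. If
  \<open>\<alpha> * dist p P\<close> is at most \<open>Y / 2\<close>, then \<open>a\<close>, being
  at least \<open>Y\<close>, leaves room for this. Otherwise \<open>dist p q\<close> is at least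
  half of \<open>dist p P\<close>, and the term with \<kappa> improves the factor \<alpha> to
  \<open>sqrt (\<alpha>\<^sup>2 + \<kappa> / 4)\<close>.\<close>

lemma dist_after_small_move:
  fixes P P' p :: "'a::metric_space"
  assumes "\<alpha> > 0" "\<kappa> > 0" "\<alpha>\<^sup>2 * (dist p P)\<^sup>2 + \<kappa> * (dist p q)\<^sup>2 \<le> a\<^sup>2" and "0 < Y" "Y \<le> a"
    and "dist q P \<le> Y / (4 * \<alpha>)" and "dist P P' \<le> \<rho>" and "\<rho> \<le> Y / (4 * \<alpha>)"
    and "\<rho> \<le> (sqrt (\<alpha>\<^sup>2 + \<kappa> / 4) - \<alpha>) / (4 * \<alpha>\<^sup>2) * Y"
  shows "\<alpha> * dist p P' + \<alpha> * \<rho> \<le> a"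
proof -
  define B where "B = dist p P"
  have "dist p P' \<le> B + \<rho>"
    unfolding B_def using assms(7) dist_triangle[of p P' P] by linarith
  then have "\<alpha> * dist p P' \<le> \<alpha> * (B + \<rho>)" using \<open>\<alpha> > 0\<close> by simp
  then have 1: "\<alpha> * dist p P' + \<alpha> * \<rho> \<le> \<alpha> * B + 2 * (\<alpha> * \<rho>)" by (simp add: algebra_simps)
  have \<alpha>\<rho>: "\<alpha> * \<rho> \<le> Y / 4" using assms by (simp add: field_simps)
  show ?thesis
  proof (cases "\<alpha> * B \<le> Y / 2")
    case True
    then show ?thesis using 1 \<alpha>\<rho> assms by linarith
  next
    case False
    then have BY: "B > Y / (2 * \<alpha>)" using \<open>\<alpha> > 0\<close> by (simp add: field_simps)
    have "B \<le> dist p q + dist q P" unfolding B_def by (rule dist_triangle)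
    moreover have "Y / (4 * \<alpha>) = Y / (2 * \<alpha>) / 2" using \<open>\<alpha> > 0\<close> by (simp add: field_simps)
    ultimately have h: "B / 2 \<le> dist p q" using BY assms(6) by linarith
    have B0: "0 \<le> B" by (simp add: B_def)
    define \<beta> where "\<beta> = sqrt (\<alpha>\<^sup>2 + \<kappa> / 4)"
    have \<beta>2: "\<beta>\<^sup>2 = \<alpha>\<^sup>2 + \<kappa> / 4" using assms by (simp add: \<beta>_def)
    have "\<beta> > \<alpha>" unfolding \<beta>_def using assms by (intro real_less_rsqrt) auto
    have "(\<beta> * B)\<^sup>2 = \<alpha>\<^sup>2 * B\<^sup>2 + \<kappa> * (B / 2)\<^sup>2"
      by (simp add: power_mult_distrib \<beta>2 field_simps)
    also have "\<dots> \<le> \<alpha>\<^sup>2 * B\<^sup>2 + \<kappa> * (dist p q)\<^sup>2"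
      using h B0 assms by (intro add_left_mono mult_left_mono power_mono) auto
    also have "\<dots> \<le> a\<^sup>2" using assms(3) by (simp add: B_def)
    finally have "\<beta> * B \<le> a" by (rule power2_le_imp_le) (use assms in linarith)
    moreover have "2 * (\<alpha> * \<rho>) \<le> (\<beta> - \<alpha>) * B"
    proof -
      have "2 * (\<alpha> * \<rho>) \<le> 2 * (\<alpha> * ((\<beta> - \<alpha>) / (4 * \<alpha>\<^sup>2) * Y))"
        using assms(9) \<open>\<alpha> > 0\<close> unfolding \<beta>_def[symmetric] by (intro mult_left_mono) auto
      also have "\<dots> = (\<beta> - \<alpha>) * (Y / (2 * \<alpha>))" using \<open>\<alpha> > 0\<close> by (simp add: power2_eq_square field_simps)
      also have "\<dots> \<le> (\<beta> - \<alpha>) * B" using \<open>\<beta> > \<alpha>\<close> BY by (intro mult_left_mono) auto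
      finally show ?thesis .
    qed
    ultimately show ?thesis using 1 by (simp add: algebra_simps)
  qed
qed

text \<open>The weak inequalities count simultaneous arrival as guarded, in accordance with capture
  on the target line. Taking \<open>P = Q\<close> covers a single pursuer.\<close>

definition guarded :: "real \<Rightarrow> real \<Rightarrow> plane \<Rightarrow> plane \<Rightarrow> plane \<Rightarrow> bool" where
  "guarded \<alpha> l y P Q \<longleftrightarrow>
     (\<forall>x\<in>{0..l}. \<alpha> * dist (x, 0) P \<le> dist (x, 0) y \<or> \<alpha> * dist (x, 0) Q \<le> dist (x, 0) y)"

text \<open>As functions of \<open>x\<close>, the differences \<open>(dist (x, 0) y)\<^sup>2 -
  \<alpha>\<^sup>2 * (dist (x, 0) R)\<^sup>2\<close> are quadratics with the common leading
  coefficient \<open>1 - \<alpha>\<^sup>2\<close>. Guarding makes the minimum of their maximum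
  nonnegative, and the growth away from the minimiser \<open>x0\<close> is the reserve that a step
  may spend. Which pursuer holds this reserve depends on \<open>x\<close>.\<close>

lemma guarded_focus:
  assumes "0 < \<alpha>" "\<alpha> < 1" "l > 0" "guarded \<alpha> l y P Q"
  obtains x0 where "x0 \<in> {0..l}"
    "\<And>x. x \<in> {0..l} \<Longrightarrow> \<exists>R\<in>{P, Q}.
       \<alpha>\<^sup>2 * (dist (x, 0) R)\<^sup>2 + (1 - \<alpha>\<^sup>2) * (dist (x, 0::real) (x0, 0))\<^sup>2 \<le> (dist (x, 0) y)\<^sup>2"
proof -
  define b where "b R = 2 * \<alpha>\<^sup>2 * fst R - 2 * fst y" for R :: plane
  define c where "c R = (fst y)\<^sup>2 + (snd y)\<^sup>2 - \<alpha>\<^sup>2 * ((fst R)\<^sup>2 + (snd R)\<^sup>2)" for R :: plane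
  have quad: "(dist (x, 0) y)\<^sup>2 - \<alpha>\<^sup>2 * (dist (x, 0) R)\<^sup>2 = (1 - \<alpha>\<^sup>2) * x\<^sup>2 + b R * x + c R" for x R
  proof -
    have sq: "(dist (x, 0) z)\<^sup>2 = (x - fst z)\<^sup>2 + (snd z)\<^sup>2" for z :: plane
      by (cases z) (simp add: dist_Pair_Pair dist_real_def)
    show ?thesis unfolding sq b_def c_def by (simp add: algebra_simps power2_eq_square)
  qed
  obtain x0 where x0: "x0 \<in> {0..l}"
    "\<And>x. x \<in> {0..l} \<Longrightarrow>
       max ((1 - \<alpha>\<^sup>2) * x\<^sup>2 + b P * x + c P) ((1 - \<alpha>\<^sup>2) * x\<^sup>2 + b Q * x + c Q) \<ge>
       max ((1 - \<alpha>\<^sup>2) * x0\<^sup>2 + b P * x0 + c P) ((1 - \<alpha>\<^sup>2) * x0\<^sup>2 + b Q * x0 + c Q) + (1 - \<alpha>\<^sup>2) * (x - x0)\<^sup>2"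
    using max_quadratic_growth[of l "1 - \<alpha>\<^sup>2" "b P" "c P" "b Q" "c Q"] \<open>l > 0\<close> by (metis less_imp_le)
  have sq: "\<alpha>\<^sup>2 * (dist (x0, 0) R)\<^sup>2 \<le> (dist (x0, 0) y)\<^sup>2" if "\<alpha> * dist (x0, 0) R \<le> dist (x0, 0) y" for R
    using power_mono[OF that, of 2] \<open>0 < \<alpha>\<close> by (simp add: power_mult_distrib)
  have "max ((1 - \<alpha>\<^sup>2) * x0\<^sup>2 + b P * x0 + c P) ((1 - \<alpha>\<^sup>2) * x0\<^sup>2 + b Q * x0 + c Q) \<ge> 0"
    unfolding quad[symmetric] using assms(4) x0(1) sq unfolding guarded_def by (fastforce simp: max_def)
  with x0 have "\<exists>R\<in>{P, Q}. (1 - \<alpha>\<^sup>2) * (x - x0)\<^sup>2 \<le> (1 - \<alpha>\<^sup>2) * x\<^sup>2 + b R * x + c R" if "x \<in> {0..l}" for x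
    using x0(2)[OF that] by (auto simp: max_def split: if_splits)
  then show ?thesis
    using x0(1) that[of x0] unfolding quad[symmetric]
    by (simp add: dist_Pair_Pair dist_real_def algebra_simps)
qed

text \<open>A step of length at most \<rho> in direction \<open>d\<close> stays on a segment from
  \<open>P\<close> to a point of the target line, so it cannot leave a convex domain that contains
  both.\<close>

definition aimed :: "real \<Rightarrow> real \<Rightarrow> plane \<Rightarrow> plane \<Rightarrow> bool" where
  "aimed l \<rho> P d \<longleftrightarrow> norm d = 1 \<and> (\<exists>x\<in>{0..l}. \<exists>r\<ge>\<rho>. (x, 0) = P + r *\<^sub>R d)"

lemma aimed_sgn:
  assumes "x \<in> {0..l}" "\<rho> \<le> dist (x, 0) P" "P \<noteq> (x, 0)"
  shows "aimed l \<rho> P (sgn ((x, 0) - P))"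
proof -
  have "(x, 0) = P + dist (x, 0) P *\<^sub>R sgn ((x, 0) - P)"
    using assms(3) by (simp add: sgn_div_norm dist_norm)
  moreover have "norm (sgn ((x, 0) - P)) = 1" using assms(3) by (simp add: norm_sgn)
  ultimately show ?thesis using assms unfolding aimed_def by blast
qed

text \<open>The end points of the target line are \<open>l\<close> apart, so one of them is at least
  \<open>l / 2\<close> away from \<open>P\<close>. This is why step lengths are capped at
  \<open>l / 2\<close>.\<close>

lemma aimed_exists:
  assumes "l > 0" "\<rho> \<le> l / 2"
  shows "\<exists>d. aimed l \<rho> P d"
proof -
  have "l = dist (0, 0::real) (l, 0)" using assms by (simp add: dist_Pair_Pair dist_real_def)
  also have "\<dots> \<le> dist (0, 0) P + dist (l, 0) P" by (rule dist_triangle2)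
  finally have "dist (0, 0) P \<ge> l / 2 \<or> dist (l, 0) P \<ge> l / 2" by linarith
  then have "\<exists>x\<in>{0, l}. dist (x, 0) P \<ge> l / 2" by simp
  then obtain x where x: "x \<in> {0, l}" "dist (x, 0) P \<ge> l / 2" by blast
  moreover have "x \<in> {0..l}" using x assms by auto
  moreover have "P \<noteq> (x, 0)" using x assms by auto
  ultimately show ?thesis using aimed_sgn[of x l \<rho> P] assms by fastforce
qed

text \<open>A pursuer far from the focus runs towards it, and one close to it takes any aimed
  direction. In both cases a margin of \<open>\<alpha> * \<rho>\<close> is left, which is as much as
  the evader can gain by its own move. The constant \<open>c\<close> is independent of all
  positions, so steps shrink to zero only together with the evader's distance from the line. Aimed
  directions are provided even when the line is not guarded, so that a strategy built from them is
  total.\<close>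

lemma guarded_step:
  assumes \<alpha>: "0 < \<alpha>" "\<alpha> < 1" and l: "l > 0"
  obtains c where "c > 0" "c \<le> 1 / (4 * \<alpha>)"
    "\<And>y P Q \<rho>. \<rho> = min (c * \<bar>snd y\<bar>) (l / 2) \<Longrightarrow> \<exists>\<delta>. (\<forall>R. aimed l \<rho> R (\<delta> R)) \<and>
       (snd y < 0 \<longrightarrow> guarded \<alpha> l y P Q \<longrightarrow>
         (\<forall>y'. dist y y' \<le> \<alpha> * \<rho> \<longrightarrow> guarded \<alpha> l y' (P + \<rho> *\<^sub>R \<delta> P) (Q + \<rho> *\<^sub>R \<delta> Q)))"
proof -
  define \<kappa> where "\<kappa> = 1 - \<alpha>\<^sup>2"
  have \<kappa>: "\<kappa> > 0" using \<alpha> by (simp add: \<kappa>_def power_less_one_iff abs_square_less_1)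
  \<comment> \<open>At distance at least \<open>C * \<rho>\<close> from the focus, \<rho> is at most
    \<open>dist q R\<close> and at most \<open>\<kappa> / \<alpha>\<^sup>2 * dist q R / 2\<close>,
    as the estimate for an approaching pursuer requires.\<close>
  define C where "C = max 1 (2 * \<alpha>\<^sup>2 / \<kappa>)"
  have C: "C \<ge> 1" "C \<ge> 2 * \<alpha>\<^sup>2 / \<kappa>" by (auto simp: C_def)
  define \<beta> where "\<beta> = sqrt (\<alpha>\<^sup>2 + \<kappa> / 4)"
  have "\<beta> > \<alpha>" unfolding \<beta>_def using \<alpha> \<kappa> by (intro real_less_rsqrt) auto
  \<comment> \<open>The first bound makes a pursuer within \<open>C * \<rho>\<close> of the focus
    close enough for the small-move estimate; the second is the last hypothesis of that
    estimate.\<close>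
  define c where "c = min (1 / (4 * \<alpha> * C)) ((\<beta> - \<alpha>) / (4 * \<alpha>\<^sup>2))"
  have c0: "c > 0" using \<alpha> C \<open>\<beta> > \<alpha>\<close> by (simp add: c_def)
  have "1 / (4 * \<alpha> * C) \<le> 1 / (4 * \<alpha>)" using C \<alpha> by (intro divide_left_mono) auto
  then have c1: "c \<le> 1 / (4 * \<alpha>)" by (simp add: c_def)
  show ?thesis
  proof (rule that[OF c0 c1])
    fix y P Q :: plane and \<rho> :: real
    assume \<rho>: "\<rho> = min (c * \<bar>snd y\<bar>) (l / 2)"
    obtain far where far: "\<And>R. aimed l \<rho> R (far R)"
      using aimed_exists[OF l, of \<rho>] \<rho> by (metis min.cobounded2)
    show "\<exists>\<delta>. (\<forall>R. aimed l \<rho> R (\<delta> R)) \<and> (snd y < 0 \<longrightarrow> guarded \<alpha> l y P Q \<longrightarrow>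
         (\<forall>y'. dist y y' \<le> \<alpha> * \<rho> \<longrightarrow> guarded \<alpha> l y' (P + \<rho> *\<^sub>R \<delta> P) (Q + \<rho> *\<^sub>R \<delta> Q)))"
    proof (cases "snd y < 0 \<and> guarded \<alpha> l y P Q")
      case False
      then show ?thesis using far by blast
    next
      case True
      define Y where "Y = \<bar>snd y\<bar>"
      have Y: "Y > 0" using True by (simp add: Y_def)
      have \<rho>0: "\<rho> > 0" using \<rho> c0 Y l by (simp add: Y_def)
      have \<rho>c: "\<rho> \<le> c * Y" using \<rho> by (simp add: Y_def)
      have \<rho>1: "C * \<rho> \<le> Y / (4 * \<alpha>)"
      proof -
        have "C * \<rho> \<le> C * (1 / (4 * \<alpha> * C) * Y)"
          using \<rho>c C Y order_trans[OF \<rho>c mult_right_mono[of c "1 / (4 * \<alpha> * C)" Y]]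
          by (intro mult_left_mono) (auto simp: c_def)
        also have "\<dots> = Y / (4 * \<alpha>)" using C by simp
        finally show ?thesis .
      qed
      have \<rho>2: "\<rho> \<le> (\<beta> - \<alpha>) / (4 * \<alpha>\<^sup>2) * Y"
        using Y order_trans[OF \<rho>c mult_right_mono[of c "(\<beta> - \<alpha>) / (4 * \<alpha>\<^sup>2)" Y]] by (simp add: c_def)
      have \<rho>3: "\<rho> \<le> Y / (4 * \<alpha>)"
        using \<rho>1 mult_right_mono[OF C(1), of \<rho>] \<rho>0 by linarith
      obtain x0 where x0: "x0 \<in> {0..l}"
        "\<And>x. x \<in> {0..l} \<Longrightarrow> \<exists>R\<in>{P, Q}.
           \<alpha>\<^sup>2 * (dist (x, 0) R)\<^sup>2 + \<kappa> * (dist (x, 0::real) (x0, 0))\<^sup>2 \<le> (dist (x, 0) y)\<^sup>2"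
        using guarded_focus[OF \<alpha> l] True unfolding \<kappa>_def by metis
      define q :: plane where "q = (x0, 0)"
      define \<delta> where "\<delta> R = (if dist q R \<ge> C * \<rho> then sgn (q - R) else far R)" for R
      have pos: "dist q R > 0" "\<rho> \<le> dist q R" if "dist q R \<ge> C * \<rho>" for R
        using that mult_right_mono[OF C(1), of \<rho>] \<rho>0 by linarith+
      have aim: "aimed l \<rho> R (\<delta> R)" for R
        using far[of R] aimed_sgn[OF x0(1), of \<rho> R] pos[of R]
        by (auto simp: \<delta>_def q_def)
      have "\<alpha> * dist (x, 0) (R + \<rho> *\<^sub>R \<delta> R) + \<alpha> * \<rho> \<le> dist (x, 0) y"
        if R: "\<alpha>\<^sup>2 * (dist (x, 0) R)\<^sup>2 + \<kappa> * (dist (x, 0) q)\<^sup>2 \<le> (dist (x, 0) y)\<^sup>2" for x R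
      proof -
        have Ya: "Y \<le> dist (x, 0) y"
          using dist_snd_le[of "(x, 0)" y] by (simp add: Y_def dist_real_def)
        show ?thesis
        proof (cases "dist q R \<ge> C * \<rho>")
          case True
          have "(dist (x, 0) R)\<^sup>2 + \<kappa> / \<alpha>\<^sup>2 * (dist (x, 0) q)\<^sup>2 \<le> (dist (x, 0) y / \<alpha>)\<^sup>2"
            using divide_right_mono[OF R, of "\<alpha>\<^sup>2"] \<alpha> by (simp add: add_divide_distrib power_divide)
          moreover have "\<rho> \<le> dist (x, 0) y / \<alpha> / 4"
            using \<rho>3 Ya \<alpha> by (simp add: field_simps)
          moreover have "\<rho> \<le> \<kappa> / \<alpha>\<^sup>2 * dist q R / 2"
          proof -
            have "2 * \<alpha>\<^sup>2 / \<kappa> * \<rho> \<le> dist q R"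
              using True C mult_right_mono[OF C(2), of \<rho>] \<rho>0 by linarith
            then show ?thesis using \<kappa> \<alpha> by (simp add: field_simps)
          qed
          ultimately have "dist (x, 0) (R + \<rho> *\<^sub>R sgn (q - R)) + \<rho> \<le> dist (x, 0) y / \<alpha>"
            using pos[OF True] Ya Y \<alpha> \<kappa> \<rho>0 by (intro dist_after_approach[where k = "\<kappa> / \<alpha>\<^sup>2"]) auto
          then show ?thesis using True \<alpha> by (simp add: \<delta>_def field_simps)
        next
          case False
          have "dist R (R + \<rho> *\<^sub>R \<delta> R) \<le> \<rho>"
            using aim[of R] \<rho>0 by (simp add: aimed_def dist_norm)
          then show ?thesis
            using False \<rho>1 \<rho>2 \<rho>3 Ya Y \<alpha> \<kappa> R
            by (intro dist_after_small_move[of \<alpha> \<kappa> _ _ q _ Y]) (auto simp: \<beta>_def)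
        qed
      qed
      then have near: "\<exists>R\<in>{P, Q}. \<alpha> * dist (x, 0) (R + \<rho> *\<^sub>R \<delta> R) + \<alpha> * \<rho> \<le> dist (x, 0) y"
        if "x \<in> {0..l}" for x using x0(2)[OF that] unfolding q_def by blast
      have far': "dist (x, 0) y \<le> dist (x, 0) y' + \<alpha> * \<rho>" if "dist y y' \<le> \<alpha> * \<rho>" for x y'
        using that dist_triangle[of "(x, 0)" y y'] by (simp add: dist_commute)
      have "guarded \<alpha> l y' (P + \<rho> *\<^sub>R \<delta> P) (Q + \<rho> *\<^sub>R \<delta> Q)" if y': "dist y y' \<le> \<alpha> * \<rho>" for y'
        unfolding guarded_def
      proof
        fix x assume "x \<in> {0..l}"
        then obtain R where "R \<in> {P, Q}" "\<alpha> * dist (x, 0) (R + \<rho> *\<^sub>R \<delta> R) + \<alpha> * \<rho> \<le> dist (x, 0) y"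
          using near by blast
        moreover from this have "\<alpha> * dist (x, 0) (R + \<rho> *\<^sub>R \<delta> R) \<le> dist (x, 0) y'"
          using far'[OF y', of x] by linarith
        ultimately show "\<alpha> * dist (x, 0) (P + \<rho> *\<^sub>R \<delta> P) \<le> dist (x, 0) y' \<or>
            \<alpha> * dist (x, 0) (Q + \<rho> *\<^sub>R \<delta> Q) \<le> dist (x, 0) y'" by blast
      qed
      with aim show ?thesis by blast
    qed
  qed
qed

section \<open>Controls and positions\<close>

lemma control_integrable:
  fixes u :: "real \<Rightarrow> plane"
  assumes u: "u \<in> borel_measurable (lebesgue_on {0..})" "\<And>t. t \<ge> 0 \<Longrightarrow> norm (u t) = 1" and "a \<ge> 0"
  shows "u integrable_on {a..b}"
proof (rule measurable_bounded_by_integrable_imp_integrable)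
  show "u \<in> borel_measurable (lebesgue_on {a..b})"
    using u(1) by (rule measurable_restrict_mono) (use \<open>a \<ge> 0\<close> in auto)
  show "(\<lambda>_. 1) integrable_on {a..b}" by (rule integrable_const_ivl)
  show "norm (u t) \<le> 1" if "t \<in> {a..b}" for t using u(2)[of t] that \<open>a \<ge> 0\<close> by simp
qed simp

lemma position_0 [simp]: "position v x u 0 = x"
  by (simp add: position_def)

lemma position_split:
  assumes u: "u \<in> borel_measurable (lebesgue_on {0..})" "\<And>t. t \<ge> 0 \<Longrightarrow> norm (u t) = 1"
    and "0 \<le> s" "s \<le> t"
  shows "position v x u t = position v x u s + v *\<^sub>R integral {s..t} u"
proof -
  have "integral {0..s} u + integral {s..t} u = integral {0..t} u"
    using assms by (intro Henstock_Kurzweil_Integration.integral_combine control_integrable) auto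
  then show ?thesis by (simp add: position_def scaleR_add_right[symmetric] add.assoc)
qed

lemma position_lipschitz:
  assumes u: "u \<in> borel_measurable (lebesgue_on {0..})" "\<And>t. t \<ge> 0 \<Longrightarrow> norm (u t) = 1"
    and "0 \<le> s" "s \<le> t" "v \<ge> 0"
  shows "dist (position v x u s) (position v x u t) \<le> v * (t - s)"
proof -
  have "norm (integral {s..t} u) \<le> integral {s..t} (\<lambda>_. 1)"
    using assms by (intro integral_norm_bound_integral control_integrable) auto
  then have "norm (integral {s..t} u) \<le> t - s" using \<open>s \<le> t\<close> by simp
  then show ?thesis
    using \<open>v \<ge> 0\<close> by (simp add: position_split[OF assms(1-4), of v x] dist_norm mult_left_mono)
qed

lemma continuous_on_position:
  assumes u: "u \<in> borel_measurable (lebesgue_on {0..})" "\<And>t. t \<ge> 0 \<Longrightarrow> norm (u t) = 1"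
    and "v \<ge> 0"
  shows "continuous_on {0..} (position v x u)"
proof (rule lipschitz_on_continuous_on)
  show "v-lipschitz_on {0..} (position v x u)"
  proof (rule lipschitz_onI)
    fix s t :: real assume "s \<in> {0..}" "t \<in> {0..}"
    then show "dist (position v x u s) (position v x u t) \<le> v * dist s t"
      using position_lipschitz[OF u, of s t v x] position_lipschitz[OF u, of t s v x] \<open>v \<ge> 0\<close>
      by (cases "s \<le> t") (auto simp: dist_commute dist_real_def)
  qed (rule \<open>v \<ge> 0\<close>)
qed

lemma controlsD:
  assumes "u \<in> controls \<Omega> v x"
  shows "u \<in> borel_measurable (lebesgue_on {0..})" "\<And>t. t \<ge> 0 \<Longrightarrow> norm (u t) = 1"
    "\<And>t. t \<ge> 0 \<Longrightarrow> position v x u t \<in> \<Omega>"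
  using assms by (auto simp: controls_def)

lemma position_constant_on:
  assumes u: "u \<in> borel_measurable (lebesgue_on {0..})" "\<And>t. t \<ge> 0 \<Longrightarrow> norm (u t) = 1"
    and "0 \<le> s" "s \<le> t" "\<And>r. s \<le> r \<Longrightarrow> r < t \<Longrightarrow> u r = d"
  shows "position v x u t = position v x u s + (v * (t - s)) *\<^sub>R d"
proof -
  have "integral {s..t} u = integral {s..t} (\<lambda>_. d)"
    by (rule integral_spike[of "{t}"]) (use assms in auto)
  then show ?thesis using \<open>s \<le> t\<close> by (simp add: position_split[OF assms(1-4)])
qed

lemma position_cong_AE:
  assumes "AE s in lebesgue_on {0..t}. u s = u' s"
  shows "position v x u t = position v x u' t"
proof -
  have "AE s in lebesgue. s \<in> {0..t} \<longrightarrow> u s = u' s"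
    using assms by (simp add: AE_restrict_space_iff)
  then obtain N where N: "{s. \<not> (s \<in> {0..t} \<longrightarrow> u s = u' s)} \<subseteq> N" "N \<in> null_sets lebesgue"
    unfolding eventually_ae_filter by auto
  have "integral {0..t} u = integral {0..t} u'"
    by (rule integral_spike[of N]) (use N in \<open>auto simp: negligible_iff_null_sets\<close>)
  then show ?thesis by (simp add: position_def)
qed

section \<open>Concatenation of controls\<close>

definition then_control :: "real \<Rightarrow> (real \<Rightarrow> plane) \<Rightarrow> (real \<Rightarrow> plane) \<Rightarrow> real \<Rightarrow> plane" where
  "then_control \<tau> u w = (\<lambda>t. if t < \<tau> then u t else w (t - \<tau>))"

lemma then_control_measurable:
  assumes u: "u \<in> borel_measurable (lebesgue_on {0..})" and w: "w \<in> borel_measurable (lebesgue_on {0..})"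
    and "\<tau> \<ge> 0"
  shows "then_control \<tau> u w \<in> borel_measurable (lebesgue_on {0..})"
proof -
  \<comment> \<open>\<open>w\<close> is measurable on the half-line only. Its extension by zero is
    measurable on the whole line and can be composed with the translation by \<tau>, an affine and
    hence Lebesgue measurable map.\<close>
  have "(\<lambda>t. if t \<in> {0..} then w t else 0) \<in> borel_measurable lebesgue"
    using w by (rule borel_measurable_if_I) simp
  moreover have "(\<lambda>t. t - \<tau>) \<in> lebesgue \<rightarrow>\<^sub>M lebesgue"
  proof -
    have "(\<lambda>t. - \<tau> + 1 *\<^sub>R t) \<in> lebesgue \<rightarrow>\<^sub>M lebesgue"
      using lebesgue_affine_measurable[of "\<lambda>_. 1" "- \<tau>"] by simp
    then show ?thesis by simp
  qed
  ultimately have "(\<lambda>t. if t - \<tau> \<in> {0..} then w (t - \<tau>) else 0) \<in> borel_measurable lebesgue"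
    by (rule measurable_compose[rotated])
  moreover define h where "h t = (if t - \<tau> \<in> {0..} then w (t - \<tau>) else 0)" for t
  ultimately have [measurable]: "h \<in> borel_measurable (lebesgue_on {0..})"
    unfolding h_def by (intro measurable_restrict_space1)
  have [measurable]: "u \<in> borel_measurable (lebesgue_on {0..})" by (rule u)
  have [measurable]: "(\<lambda>s. s) \<in> borel_measurable (lebesgue_on {0::real..})"
    using id_borel_measurable_lebesgue_on[of "{0::real..}"] by (simp add: id_def)
  have "(\<lambda>t. if t < \<tau> then u t else h t) \<in> borel_measurable (lebesgue_on {0..})"
    by measurable
  then show ?thesis
    unfolding then_control_def by (rule measurable_cong[THEN iffD1, rotated]) (auto simp: h_def)
qed

lemma position_then_control:
  assumes u: "u \<in> borel_measurable (lebesgue_on {0..})" "\<And>t. t \<ge> 0 \<Longrightarrow> norm (u t) = 1"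
    and w: "w \<in> borel_measurable (lebesgue_on {0..})" "\<And>t. t \<ge> 0 \<Longrightarrow> norm (w t) = 1"
    and "\<tau> \<ge> 0" "t \<ge> 0"
  shows "position v x (then_control \<tau> u w) t =
    (if t \<le> \<tau> then position v x u t else position v (position v x u \<tau>) w (t - \<tau>))"
proof -
  let ?U = "then_control \<tau> u w"
  have U: "?U \<in> borel_measurable (lebesgue_on {0..})" using assms by (intro then_control_measurable)
  have U1: "norm (?U t) = 1" if "t \<ge> 0" for t
    using that u(2)[of t] w(2)[of "t - \<tau>"] by (simp add: then_control_def)
  have early: "position v x ?U t = position v x u t" if "t \<le> \<tau>" for t
  proof -
    have "integral {0..t} ?U = integral {0..t} u"
      by (rule integral_spike[of "{\<tau>}"]) (use that in \<open>auto simp: then_control_def\<close>)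
    then show ?thesis by (simp add: position_def)
  qed
  show ?thesis
  proof (cases "t \<le> \<tau>")
    case True
    then show ?thesis using early by simp
  next
    case False
    have "(w has_integral integral {0..t - \<tau>} w) (cbox 0 (t - \<tau>))"
      using control_integrable[OF w, of 0 "t - \<tau>"] by (simp add: integrable_integral)
    from has_integral_affinity[OF this, of 1 "-\<tau>"]
    have "((\<lambda>s. w (s - \<tau>)) has_integral integral {0..t - \<tau>} w) {\<tau>..t}"
      using False by simp
    then have "integral {\<tau>..t} (\<lambda>s. w (s - \<tau>)) = integral {0..t - \<tau>} w" by (rule integral_unique)
    moreover have "integral {\<tau>..t} ?U = integral {\<tau>..t} (\<lambda>s. w (s - \<tau>))"
      by (rule integral_cong) (auto simp: then_control_def)
    ultimately have "integral {\<tau>..t} ?U = integral {0..t - \<tau>} w" by simp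
    then show ?thesis
      using False position_split[OF U U1, of \<tau> t v x] \<open>\<tau> \<ge> 0\<close> early[of \<tau>]
      by (simp add: position_def)
  qed
qed

lemma then_control_in_controls:
  assumes u: "u \<in> borel_measurable (lebesgue_on {0..})" "\<And>t. t \<ge> 0 \<Longrightarrow> norm (u t) = 1"
    and \<Omega>: "\<And>t. 0 \<le> t \<Longrightarrow> t \<le> \<tau> \<Longrightarrow> position v x u t \<in> \<Omega>"
    and w: "w \<in> controls \<Omega> v (position v x u \<tau>)" and "\<tau> \<ge> 0"
  shows "then_control \<tau> u w \<in> controls \<Omega> v x"
proof -
  have "norm (then_control \<tau> u w t) = 1" if "t \<ge> 0" for t
    using that u(2)[of t] controlsD(2)[OF w, of "t - \<tau>"] by (simp add: then_control_def)
  moreover have "position v x (then_control \<tau> u w) t \<in> \<Omega>" if "t \<ge> 0" for t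
    using position_then_control[OF u controlsD(1,2)[OF w] \<open>\<tau> \<ge> 0\<close> that, of v x]
      \<Omega>[of t] controlsD(3)[OF w, of "t - \<tau>"] that by (cases "t \<le> \<tau>") simp_all
  ultimately show ?thesis
    using then_control_measurable[OF u(1) controlsD(1)[OF w] \<open>\<tau> \<ge> 0\<close>] by (simp add: controls_def)
qed

text \<open>The value \<open>g s\<close> is used after the accumulation point of the switching times \<open>T n\<close>, if any.\<close>

definition switched :: "(nat \<Rightarrow> real) \<Rightarrow> (nat \<Rightarrow> plane) \<Rightarrow> (real \<Rightarrow> plane) \<Rightarrow> real \<Rightarrow> plane" where
  "switched T d g s = (if \<exists>n. s < T (Suc n) then d (LEAST n. s < T (Suc n)) else g s)"

lemma switched_eq:
  assumes "mono T" "T n \<le> s" "s < T (Suc n)"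
  shows "switched T d g s = d n"
proof -
  have "(LEAST n. s < T (Suc n)) = n"
  proof (rule Least_equality)
    fix m assume "s < T (Suc m)"
    then show "n \<le> m" using assms monoD[OF \<open>mono T\<close>, of "Suc m" n] by (meson leD le_less_trans not_less_eq_eq order.strict_trans2 order_trans)
  qed (rule assms)
  then show ?thesis using assms(3) by (auto simp: switched_def)
qed

lemma switched_measurable:
  assumes "g \<in> borel_measurable (lebesgue_on {0..})"
  shows "switched T d g \<in> borel_measurable (lebesgue_on {0..})"
proof -
  have [measurable]: "g \<in> borel_measurable (lebesgue_on {0..})" by (rule assms)
  have [measurable]: "(\<lambda>s. s) \<in> borel_measurable (lebesgue_on {0::real..})"
    using id_borel_measurable_lebesgue_on[of "{0::real..}"] by (simp add: id_def)
  have [measurable]: "d \<in> count_space UNIV \<rightarrow>\<^sub>M borel" by simp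
  have "(\<lambda>s. if \<exists>n. s < T (Suc n) then d (LEAST n. s < T (Suc n)) else g s) \<in> borel_measurable (lebesgue_on {0..})"
    by measurable
  then show ?thesis by (simp add: switched_def[abs_def])
qed

text \<open>The trajectory is the polygon with vertices \<open>X n\<close>. The right end of each
  interval is included, although the control may already have switched there, because a single
  instant does not affect the integral.\<close>

lemma position_switched:
  fixes T :: "nat \<Rightarrow> real" and v :: real and d :: "nat \<Rightarrow> plane"
  defines "u \<equiv> switched T d (\<lambda>_. (1, 0))"
  assumes T: "mono T" "T 0 = 0" and d: "\<And>n. norm (d n) = 1"
    and X: "\<And>n. X (Suc n) = X n + (v * (T (Suc n) - T n)) *\<^sub>R d n"
    and s: "T n \<le> s" "s \<le> T (Suc n)"
  shows "position v (X 0) u s = X n + (v * (s - T n)) *\<^sub>R d n"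
proof -
  have u: "u \<in> borel_measurable (lebesgue_on {0..})"
    unfolding u_def by (rule switched_measurable) simp
  have u1: "norm (u t) = 1" if "t \<ge> 0" for t
    using d by (auto simp: u_def switched_def norm_Pair)
  have T0: "0 \<le> T n" for n using monoD[OF T(1), of 0 n] T(2) by simp
  have piece: "position v (X 0) u r = position v (X 0) u (T n) + (v * (r - T n)) *\<^sub>R d n"
    if "T n \<le> r" "r \<le> T (Suc n)" for n r
    using u u1 T0 that(1) by (rule position_constant_on) (use that T(1) in \<open>auto simp: u_def intro!: switched_eq\<close>)
  have "position v (X 0) u (T n) = X n" for n
  proof (induction n)
    case 0
    then show ?case by (simp add: T)
  next
    case (Suc n)
    then show ?case using piece[of n "T (Suc n)"] monoD[OF T(1), of n "Suc n"] by (simp add: X)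
  qed
  then show ?thesis using piece[OF s] by simp
qed

text \<open>Controls have norm 1, so a player cannot rest. Shuttling for ever on the segment between
  \<open>x\<close> and \<open>z\<close> is admissible by convexity.\<close>

lemma controls_nonempty:
  assumes "convex \<Omega>" "x \<in> \<Omega>" "z \<in> \<Omega>" "x \<noteq> z" "v > 0"
  shows "controls \<Omega> v x \<noteq> {}"
proof -
  define L where "L = dist x z / v"
  have L: "L > 0" using assms by (simp add: L_def)
  define T where "T n = real n * L" for n
  define d where "d n = (if even n then sgn (z - x) else - sgn (z - x))" for n :: nat
  define X where "X n = (if even n then x else z)" for n :: nat
  define u where "u = switched T d (\<lambda>_. (1, 0))"
  have d1: "norm (d n) = 1" for n using \<open>x \<noteq> z\<close> by (simp add: d_def norm_sgn)
  have mono: "mono T" unfolding T_def using L by (intro monoI mult_right_mono) auto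
  have vL: "v * L = norm (z - x)" using assms by (simp add: L_def dist_norm norm_minus_commute)
  have X: "X (Suc n) = X n + (v * (T (Suc n) - T n)) *\<^sub>R d n" for n
  proof -
    have "v * (T (Suc n) - T n) = norm (z - x)" by (simp add: T_def vL[symmetric] algebra_simps)
    then show ?thesis using \<open>x \<noteq> z\<close> by (simp add: X_def d_def sgn_div_norm)
  qed
  have "position v x u t \<in> \<Omega>" if t: "t \<ge> 0" for t
  proof -
    define n where "n = nat \<lfloor>t / L\<rfloor>"
    have "real n \<le> t / L" "t / L < real n + 1" unfolding n_def using t L by auto
    then have n: "T n \<le> t" "t \<le> T (Suc n)" using L by (auto simp: T_def field_simps)
    have X0: "X 0 = x" by (simp add: X_def)
    define \<mu> where "\<mu> = (t - T n) / L"
    have \<mu>: "0 \<le> \<mu>" "\<mu> \<le> 1" using n L by (auto simp: \<mu>_def T_def field_simps)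
    have "position v x u t = X n + (v * (t - T n)) *\<^sub>R d n"
      using position_switched[OF mono _ d1 X n] unfolding X0 u_def by (simp add: T_def[of 0])
    also have "\<dots> = (1 - \<mu>) *\<^sub>R X n + \<mu> *\<^sub>R X (Suc n)"
    proof -
      have "v * (t - T n) = \<mu> * (v * (T (Suc n) - T n))" using L by (simp add: \<mu>_def T_def field_simps)
      then have "(v * (t - T n)) *\<^sub>R d n = \<mu> *\<^sub>R (X (Suc n) - X n)" unfolding X[of n] by simp
      then show ?thesis by (simp add: algebra_simps)
    qed
    also have "\<dots> \<in> \<Omega>"
      using assms \<mu> by (intro convexD) (auto simp: X_def)
    finally show ?thesis .
  qed
  moreover have "u \<in> borel_measurable (lebesgue_on {0..})"
    unfolding u_def by (rule switched_measurable) simp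
  moreover have "norm (u t) = 1" for t
    using d1 by (auto simp: u_def switched_def norm_Pair)
  ultimately show ?thesis by (auto simp: controls_def)
qed

section \<open>The evader's straight run\<close>

lemma play_region_eq: "play_region \<Omega> = {x \<in> \<Omega>. snd x < 0}"
  by (auto simp: play_region_def target_region_def)

lemma target_line_eq:
  assumes "l > 0"
  shows "target_line l = (\<lambda>x. (x, 0)) ` {0..l}"
proof -
  have "target_line l = (\<lambda>u. (u * l, 0)) ` {0..1}"
    by (auto simp: target_line_def closed_segment_def)
  also have "\<dots> = (\<lambda>x. (x, 0)) ` (\<lambda>u. u * l) ` {0..1}" by (simp add: image_image)
  also have "(\<lambda>u. u * l) ` {0..1} = {0..l}"
    using assms by (subst image_mult_atLeastAtMost_if') simp_all
  finally show ?thesis .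
qed

lemma game_domain_point:
  assumes "game_domain \<Omega> l" "x \<in> {0..l}"
  shows "(x, 0) \<in> \<Omega>" "(x, 0) \<in> target_region \<Omega>"
proof -
  have "(x, 0) \<in> target_line l" using assms by (auto simp: target_line_eq game_domain_def)
  then show "(x, 0) \<in> \<Omega>" using assms(1) unfolding game_domain_def by blast
  then show "(x, 0) \<in> target_region \<Omega>" by (simp add: target_region_def)
qed

lemma game_domain_controls_nonempty:
  assumes "game_domain \<Omega> l" "v > 0" "x \<in> \<Omega>"
  shows "controls \<Omega> v x \<noteq> {}"
proof (cases "x = (0, 0)")
  case True
  then show ?thesis using controls_nonempty[of \<Omega> x "(l, 0)" v] assms game_domain_point[of \<Omega> l l]
    by (auto simp: game_domain_def)
next
  case False
  then show ?thesis using controls_nonempty[of \<Omega> x "(0, 0)" v] assms game_domain_point[of \<Omega> l 0]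
    by (auto simp: game_domain_def)
qed

text \<open>Not having arrived and not having been caught are finitely many open conditions on
  continuous trajectories, so they persist a little beyond \<open>s\<close>. Hence there is no last
  instant at which the game is ongoing.\<close>

lemma ongoing_extends:
  assumes "finite K" "s \<ge> 0" "ongoing \<Omega> K e p s"
    and e: "continuous_on {0..} e" "\<And>t. t \<ge> 0 \<Longrightarrow> e t \<in> \<Omega>"
    and p: "\<And>i. i \<in> K \<Longrightarrow> continuous_on {0..} (p i)"
  obtains \<epsilon> where "\<epsilon> > 0" "\<And>t. t < s + \<epsilon> \<Longrightarrow> ongoing \<Omega> K e p t"
proof -
  have lim: "(f \<longlongrightarrow> f s) (at s within {0..})" if "continuous_on {0..} f" for f :: "real \<Rightarrow> plane"
    using that \<open>s \<ge> 0\<close> by (auto simp: continuous_on)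
  have now: "snd (e s) < 0" "\<And>i. i \<in> K \<Longrightarrow> e s \<noteq> p i s"
    using assms(2,3) by (auto simp: ongoing_def play_region_eq)
  have "eventually (\<lambda>t. snd (e t) < 0) (at s within {0..})"
    using order_tendstoD(2)[OF tendsto_snd[OF lim[OF e(1)]] now(1)] .
  moreover have "eventually (\<lambda>t. \<forall>i\<in>K. e t \<noteq> p i t) (at s within {0..})"
  proof (rule eventually_ball_finite[OF \<open>finite K\<close>], rule ballI)
    fix i assume "i \<in> K"
    have "eventually (\<lambda>t. e t - p i t \<noteq> 0) (at s within {0..})"
      by (rule tendsto_imp_eventually_ne[OF tendsto_diff[OF lim[OF e(1)] lim[OF p]]])
        (use \<open>i \<in> K\<close> now in auto)
    then show "eventually (\<lambda>t. e t \<noteq> p i t) (at s within {0..})" by simp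
  qed
  ultimately have "eventually (\<lambda>t. snd (e t) < 0 \<and> (\<forall>i\<in>K. e t \<noteq> p i t)) (at s within {0..})"
    by eventually_elim simp
  then obtain \<epsilon> where \<epsilon>: "\<epsilon> > 0"
    "\<And>t. t \<ge> 0 \<Longrightarrow> t \<noteq> s \<Longrightarrow> dist t s < \<epsilon> \<Longrightarrow> snd (e t) < 0 \<and> (\<forall>i\<in>K. e t \<noteq> p i t)"
    unfolding eventually_at by auto
  have "ongoing \<Omega> K e p t" if "t < s + \<epsilon>" for t
    unfolding ongoing_def
  proof
    fix r assume r: "r \<in> {0..t}"
    show "e r \<in> play_region \<Omega> \<and> (\<forall>i\<in>K. e r \<noteq> p i r)"
    proof (cases "r \<le> s")
      case True
      then show ?thesis using assms(3) r by (auto simp: ongoing_def)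
    next
      case False
      then show ?thesis using \<epsilon>(2)[of r] r that e(2)[of r] by (auto simp: play_region_eq dist_real_def)
    qed
  qed
  with \<epsilon>(1) that show ?thesis by blast
qed

text \<open>A pursuer met at time \<open>t\<close> has come at most \<open>vP * t\<close> and could
  accompany the evader for the rest of its way. Its distance to the target point would then be at
  most \<open>vP\<close> times the evader's arrival time, contrary to \<open>free\<close>.\<close>

lemma straight_run_before_pursuers:
  assumes v: "0 < vE" "vE \<le> vP" and y: "y \<in> play_region \<Omega>"
    and free: "vP * dist (x, 0) y < vE * dist (x, 0) z"
    and q: "q \<in> controls \<Omega> vP z"
    and t: "0 \<le> t" "t \<le> dist (x, 0) y / vE"
  shows "y + (vE * t) *\<^sub>R sgn ((x, 0) - y) \<noteq> position vP z q t"
proof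
  let ?p = "(x, 0) :: plane" and ?e = "y + (vE * t) *\<^sub>R sgn ((x, 0) - y)"
  assume meet: "?e = position vP z q t"
  have ne: "y \<noteq> ?p" using y by (auto simp: play_region_eq)
  define D where "D = dist ?p y"
  have D: "D > 0" using ne by (simp add: D_def)
  have "?p - ?e = (1 - vE * t / D) *\<^sub>R (?p - y)"
    by (simp add: D_def sgn_div_norm dist_norm divide_inverse algebra_simps)
  then have "dist ?p ?e = \<bar>1 - vE * t / D\<bar> * D" by (simp add: dist_norm D_def)
  moreover have "vE * t / D \<le> 1" using t v D by (simp add: D_def field_simps)
  ultimately have 1: "dist ?p ?e = D - vE * t" using D by (simp add: field_simps)
  have 2: "dist z ?e \<le> vP * t"
    using position_lipschitz[OF controlsD(1,2)[OF q], of 0 t vP z] t v meet by simp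
  have "dist ?p z \<le> D - vE * t + vP * t"
    using 1 2 dist_triangle[of ?p z ?e] by (simp add: dist_commute)
  also have "\<dots> = D + (vP - vE) * t" by (simp add: algebra_simps)
  also have "\<dots> \<le> D + (vP - vE) * (D / vE)"
    using t v by (intro add_left_mono mult_left_mono) (auto simp: D_def)
  also have "\<dots> = vP * D / vE" using v by (simp add: field_simps)
  finally show False using free v by (simp add: D_def field_simps)
qed

text \<open>The feedback law is the constant direction to the free target point. Two things are
  checked against every pursuit strategy: a play exists, and every play follows the segment until
  the arrival at time \<tau>.\<close>

lemma evader_region_if_free_target:
  assumes dom: "game_domain \<Omega> l" and v: "0 < vE" "vE < vP" and "finite K"
    and y: "y \<in> play_region \<Omega>" and x: "x \<in> {0..l}"
    and free: "\<And>i. i \<in> K \<Longrightarrow> vP * dist (x, 0) y < vE * dist (x, 0) (X i)"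
  shows "y \<in> evader_region \<Omega> vP vE X K"
proof -
  define p :: plane where "p = (x, 0)"
  define \<tau> where "\<tau> = dist p y / vE"
  define d where "d = sgn (p - y)"
  define line where "line t = y + (vE * t) *\<^sub>R d" for t
  have ne: "y \<noteq> p" using y by (auto simp: play_region_eq p_def)
  have \<tau>: "\<tau> > 0" using v ne by (simp add: \<tau>_def)
  have d1: "norm d = 1" using ne by (simp add: d_def norm_sgn)
  have line: "line t = (1 - t / \<tau>) *\<^sub>R y + (t / \<tau>) *\<^sub>R p" for t
    using v by (simp add: line_def d_def \<tau>_def sgn_div_norm dist_norm divide_inverse algebra_simps)
  have line\<tau>: "line \<tau> = p" using \<tau> by (simp add: line)
  have p\<Omega>: "p \<in> \<Omega>" "p \<in> target_region \<Omega>" using game_domain_point[OF dom x] by (auto simp: p_def)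
  have line_play: "line t \<in> play_region \<Omega>" if "0 \<le> t" "t < \<tau>" for t
  proof -
    have "line t \<in> \<Omega>" unfolding line
      using that p\<Omega> y dom by (intro convexD) (auto simp: game_domain_def play_region_eq)
    moreover have "snd (line t) = (1 - t / \<tau>) * snd y" by (simp add: line p_def)
    moreover have "\<dots> < 0" using that y by (auto simp: play_region_eq mult_pos_neg)
    ultimately show ?thesis by (simp add: play_region_eq)
  qed
  have line_\<Omega>: "line t \<in> \<Omega>" if "0 \<le> t" "t \<le> \<tau>" for t
    using line_play[of t] that line\<tau> p\<Omega> by (cases "t = \<tau>") (auto simp: play_region_eq)
  have const: "position vE y (\<lambda>_. d) t = line t" if "t \<ge> 0" for t
    using that by (simp add: position_def line_def)
  have caught: "line t \<noteq> position vP (X i) q t"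
    if "i \<in> K" "q \<in> controls \<Omega> vP (X i)" "0 \<le> t" "t \<le> \<tau>" for i q t
    using straight_run_before_pursuers[OF _ _ y free that(2)] that v
    by (simp add: line_def d_def p_def \<tau>_def)
  show ?thesis
    unfolding evader_region_def
  proof (intro CollectI conjI exI[of _ "\<lambda>_ _. d"] allI impI)
    fix \<gamma> assume \<gamma>: "nonanticipative \<Omega> vP vE X K y \<gamma>"
    show "\<exists>u. play \<Omega> vP vE X K y (\<lambda>_ _. d) \<gamma> u"
    proof -
      \<comment> \<open>After the arrival the law no longer binds, but a control is defined for all
        times and must keep the evader in \<Omega>; any admissible control starting at
        \<open>p\<close> serves as continuation.\<close>
      obtain w where w: "w \<in> controls \<Omega> vE p"
        using game_domain_controls_nonempty[OF dom v(1) p\<Omega>(1)] by blast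
      define u where "u = then_control \<tau> (\<lambda>_. d) w"
      have "u \<in> controls \<Omega> vE y"
        unfolding u_def using \<tau> w d1 line_\<Omega> const line\<tau>
        by (intro then_control_in_controls) auto
      moreover have u\<tau>: "position vE y u \<tau> = p"
        unfolding u_def using \<tau> d1 const[of \<tau>] line\<tau>
        by (subst position_then_control[OF _ _ controlsD(1,2)[OF w]]) auto
      have "\<not> ongoing \<Omega> K (position vE y u) q t" if "t \<ge> \<tau>" for q t
      proof
        assume "ongoing \<Omega> K (position vE y u) q t"
        then have "position vE y u \<tau> \<in> play_region \<Omega>" using that \<tau> by (simp add: ongoing_def)
        then show False using u\<tau> by (simp add: play_region_eq p_def)
      qed
      then have "u t = d" if "ongoing \<Omega> K (position vE y u) q t" for q t
        using that by (cases "t < \<tau>") (auto simp: u_def then_control_def not_less)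
      ultimately show ?thesis
        unfolding play_def Let_def by (intro exI[of _ u]) auto
    qed
    fix u assume "play \<Omega> vP vE X K y (\<lambda>_ _. d) \<gamma> u"
    then have u: "u \<in> controls \<Omega> vE y"
      and law: "AE t in lebesgue_on {0..}. ongoing \<Omega> K (position vE y u) (\<lambda>i. position vP (X i) (\<gamma> u i)) t \<longrightarrow> u t = d"
      unfolding play_def Let_def by auto
    define e where "e = position vE y u"
    define q where "q i = position vP (X i) (\<gamma> u i)" for i
    have \<gamma>u: "\<gamma> u i \<in> controls \<Omega> vP (X i)" if "i \<in> K" for i
      using \<gamma> u that by (auto simp: nonanticipative_def)
    \<comment> \<open>The law determines \<open>u\<close> only almost everywhere and only while the
      game is ongoing; the instant \<open>t\<close> itself is discarded as a null set.\<close>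
    have straight: "e t = line t" if "t \<ge> 0" "\<And>r. 0 \<le> r \<Longrightarrow> r < t \<Longrightarrow> ongoing \<Omega> K e q r" for t
    proof -
      have "AE r in lebesgue. r \<noteq> t"
        using AE_not_in[of "{t}" lebesgue] negligible_sing[of t] by (simp add: negligible_iff_null_sets)
      moreover have "AE r in lebesgue. r \<in> {0..} \<longrightarrow> ongoing \<Omega> K e q r \<longrightarrow> u r = d"
        using law by (simp add: AE_restrict_space_iff e_def q_def[abs_def])
      ultimately have "AE r in lebesgue. r \<in> {0..t} \<longrightarrow> u r = d"
        by eventually_elim (use that(2) in auto)
      then have "AE r in lebesgue_on {0..t}. u r = (\<lambda>_. d) r"
        by (simp add: AE_restrict_space_iff)
      then have "e t = position vE y (\<lambda>_. d) t"
        unfolding e_def by (rule position_cong_AE)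
      with const that(1) show ?thesis by simp
    qed
    have cont_e: "continuous_on {0..} e"
      unfolding e_def using controlsD[OF u] v by (intro continuous_on_position) auto
    have cont_q: "continuous_on {0..} (q i)" if "i \<in> K" for i
      unfolding q_def using controlsD[OF \<gamma>u[OF that]] v by (intro continuous_on_position) auto
    have ongoing: "ongoing \<Omega> K e q t" if t: "0 \<le> t" "t < \<tau>" for t
    proof (rule ccontr)
      assume not: "\<not> ongoing \<Omega> K e q t"
      \<comment> \<open>The run is straight while the game is ongoing, and the game is ongoing while
        the run is straight. To break this circle, \<open>s\<close> is the infimum of the times at
        which the game is over: the run is straight up to \<open>s\<close>, so the game is ongoing
        at \<open>s\<close> and, by continuity, slightly beyond, which contradicts the choice of
        \<open>s\<close>.\<close>
      define A where "A = {t. 0 \<le> t \<and> \<not> ongoing \<Omega> K e q t}"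
      define s where "s = Inf A"
      have A: "t \<in> A" "bdd_below A" using not t by (auto simp: A_def intro: bdd_belowI[of _ 0])
      have s: "s \<le> t" unfolding s_def using A by (rule cInf_lower)
      have s0: "0 \<le> s" unfolding s_def using A(1) by (intro cInf_greatest) (auto simp: A_def)
      have before: "ongoing \<Omega> K e q r" if "0 \<le> r" "r < s" for r
      proof (rule ccontr)
        assume "\<not> ?thesis"
        then have "s \<le> r" unfolding s_def using that A(2) by (intro cInf_lower) (auto simp: A_def)
        with that show False by simp
      qed
      have line: "e r = line r" if "0 \<le> r" "r \<le> s" for r
        using that by (intro straight before) auto
      have "ongoing \<Omega> K e q s"
        unfolding ongoing_def using line line_play caught[OF _ \<gamma>u] s s0 t by (auto simp: q_def)
      then obtain \<epsilon> where "\<epsilon> > 0" "\<And>t. t < s + \<epsilon> \<Longrightarrow> ongoing \<Omega> K e q t"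
        by (rule ongoing_extends[OF \<open>finite K\<close> s0 _ cont_e _ cont_q])
          (use controlsD(3)[OF u] in \<open>auto simp: e_def\<close>)
      moreover from this(1) obtain r where "r \<in> A" "r < s + \<epsilon>"
        using cInf_lessD[of A "s + \<epsilon>"] A(1) unfolding s_def by auto
      ultimately show False by (auto simp: A_def)
    qed
    have eline: "e t = line t" if "0 \<le> t" "t \<le> \<tau>" for t
      using that by (intro straight ongoing) auto
    have "evader_wins \<Omega> K e q"
      unfolding evader_wins_def
    proof (intro exI[of _ \<tau>] conjI ballI)
      show "e \<tau> \<in> target_region \<Omega>" using eline[of \<tau>] \<tau> line\<tau> p\<Omega> by simp
      show "e s \<in> play_region \<Omega>" if "s \<in> {0..<\<tau>}" for s
        using that eline line_play by simp
      show "e s \<noteq> q i s" if "s \<in> {0..\<tau>}" "i \<in> K" for s i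
        using that eline caught[OF _ \<gamma>u] by (simp add: q_def)
    qed (use \<tau> in simp)
    then show "evader_wins \<Omega> K (position vE y u) (\<lambda>i. position vP (X i) (\<gamma> u i))"
      by (simp add: e_def q_def[abs_def])
  qed (use y d1 in auto)
qed

section \<open>The sampled pursuit strategy\<close>

text \<open>\<open>\<rho> z\<close> is a distance, so a step takes the time \<open>\<rho> z / v\<close>. It will be proportional to the distance of
  the evader from the target line, which makes the sampling times accumulate when the evader arrives.\<close>

primrec sampled ::
  "(plane \<Rightarrow> real) \<Rightarrow> (plane \<Rightarrow> (nat \<Rightarrow> plane) \<Rightarrow> nat \<Rightarrow> plane) \<Rightarrow> real \<Rightarrow> (nat \<Rightarrow> plane) \<Rightarrow>
   (real \<Rightarrow> plane) \<Rightarrow> nat \<Rightarrow> real \<times> (nat \<Rightarrow> plane)" where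
  "sampled \<rho> D v X e 0 = (0, X)"
| "sampled \<rho> D v X e (Suc n) = (let (t, Z) = sampled \<rho> D v X e n in
     (t + \<rho> (e t) / v, \<lambda>k. Z k + \<rho> (e t) *\<^sub>R D (e t) Z k))"

text \<open>An arbitrary admissible continuation for the time after the sampling times have
  accumulated. It is chosen from the position alone, so equal pasts are continued in the same
  way.\<close>

definition stay :: "plane set \<Rightarrow> real \<Rightarrow> plane \<Rightarrow> real \<Rightarrow> plane" where
  "stay \<Omega> v x = (SOME w. w \<in> controls \<Omega> v x)"

text \<open>\<open>\<rho> z\<close> is the step length and \<open>D z Z k\<close> the direction of
  pursuer \<open>k\<close> when the evader is sampled at \<open>z\<close> and the pursuers at
  \<open>Z\<close>. Admissibility and causality of the strategy rest on the aiming condition, and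
  can thus be settled separately from the guarding of the line.\<close>

locale sampled_pursuit =
  fixes \<Omega> :: "plane set" and l vP vE :: real and X :: "nat \<Rightarrow> plane" and y :: plane
    and \<rho> :: "plane \<Rightarrow> real" and D :: "plane \<Rightarrow> (nat \<Rightarrow> plane) \<Rightarrow> nat \<Rightarrow> plane"
  assumes dom: "game_domain \<Omega> l" and vP: "vP > 0"
    and \<rho>: "\<And>z. \<rho> z \<ge> 0" and aim: "\<And>z Z k. aimed l (\<rho> z) (Z k) (D z Z k)"
begin

abbreviation "trail u \<equiv> position vE y u"

definition "time u n = fst (sampled \<rho> D vP X (trail u) n)"
definition "place u n = snd (sampled \<rho> D vP X (trail u) n)"
definition "heading u k n = D (trail u (time u n)) (place u n) k"
definition "chase u k = switched (time u) (heading u k) (\<lambda>_. (1, 0))"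
text \<open>If the sampling times accumulate at \<tau>, then \<open>chase\<close> has only a default
  direction from \<tau> on, which might lead out of \<Omega>; an admissible control takes over
  there.\<close>

definition "pursuit u k =
  (if bdd_above (range (time u))
   then let \<tau> = SUP n. time u n in
     then_control \<tau> (chase u k) (stay \<Omega> vP (position vP (X k) (chase u k) \<tau>))
   else chase u k)"

section \<open>Sampling times and the polygonal paths of the pursuers\<close>

lemma time_0 [simp]: "time u 0 = 0" and place_0 [simp]: "place u 0 = X"
  by (simp_all add: time_def place_def)

lemma time_Suc: "time u (Suc n) = time u n + \<rho> (trail u (time u n)) / vP"
  by (simp add: time_def case_prod_beta Let_def)

lemma place_Suc: "place u (Suc n) k = place u n k + (vP * (time u (Suc n) - time u n)) *\<^sub>R heading u k n"
  using vP by (simp add: time_Suc) (simp add: time_def place_def heading_def case_prod_beta Let_def)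

lemma mono_time: "mono (time u)"
  using \<rho> vP by (intro mono_SucI1 incseq_SucI) (simp_all add: time_Suc mono_iff_le_Suc)

lemma time_nonneg: "0 \<le> time u n"
  using monoD[OF mono_time, of 0 n u] by simp

lemma norm_heading: "norm (heading u k n) = 1"
  using aim by (simp add: heading_def aimed_def)

lemma chase_measurable: "chase u k \<in> borel_measurable (lebesgue_on {0..})"
  unfolding chase_def by (rule switched_measurable) simp

lemma norm_chase: "norm (chase u k t) = 1"
  using norm_heading by (auto simp: chase_def switched_def norm_Pair)

lemma position_chase:
  assumes "time u n \<le> t" "t \<le> time u (Suc n)"
  shows "position vP (X k) (chase u k) t = place u n k + (vP * (t - time u n)) *\<^sub>R heading u k n"
  using position_switched[OF mono_time time_0, of "heading u k" "\<lambda>n. place u n k"]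
    norm_heading place_Suc assms by (simp add: chase_def)

lemma position_chase_time: "position vP (X k) (chase u k) (time u n) = place u n k"
  using position_chase[of u n "time u n" k] monoD[OF mono_time, of n "Suc n" u] by simp

lemma interval_exists:
  assumes "0 \<le> t" "t < time u m"
  obtains n where "time u n \<le> t" "t < time u (Suc n)"
proof -
  define n where "n = (LEAST n. t < time u n)"
  have n: "t < time u n" unfolding n_def using assms(2) by (rule LeastI)
  then have "n \<noteq> 0" using assms(1) by (metis not_less time_0)
  then obtain n' where n': "n = Suc n'" using not0_implies_Suc by blast
  then have "\<not> t < time u n'" using not_less_Least[of n' "\<lambda>n. t < time u n"] by (simp add: n_def)
  with n n' that show ?thesis by (auto simp: not_less)
qed

lemma tendsto_time:
  assumes "bdd_above (range (time u))"
  shows "time u \<longlonglongrightarrow> (SUP n. time u n)"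
  using LIMSEQ_incseq_SUP[OF assms mono_time] .

text \<open>For a pursuer starting in \<Omega>, this hull lies in \<Omega> and contains all legs of
  its path. Being compact, it also contains the limit of the path at an accumulation time, although
  \<Omega> itself is not assumed to be closed.\<close>

definition "zone k = convex hull (insert (X k) (target_line l))"

lemma zone:
  assumes "X k \<in> \<Omega>"
  shows "zone k \<subseteq> \<Omega>" "convex (zone k)" "closed (zone k)"
    "X k \<in> zone k" "\<And>x. x \<in> {0..l} \<Longrightarrow> (x, 0) \<in> zone k"
proof -
  have "l > 0" using dom by (simp add: game_domain_def)
  have "target_line l \<subseteq> \<Omega>" using dom by (auto simp: game_domain_def)
  then show "zone k \<subseteq> \<Omega>" unfolding zone_def
    using assms dom by (intro hull_minimal) (auto simp: game_domain_def)
  show "convex (zone k)" by (simp add: zone_def)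
  have "compact (zone k)"
    unfolding zone_def target_line_def by (intro compact_convex_hull compact_insert compact_segment)
  then show "closed (zone k)" by (rule compact_imp_closed)
  have "insert (X k) (target_line l) \<subseteq> zone k" unfolding zone_def by (rule hull_subset)
  then show "X k \<in> zone k" "\<And>x. x \<in> {0..l} \<Longrightarrow> (x, 0) \<in> zone k"
    by (auto simp: target_line_eq[OF \<open>l > 0\<close>])
qed

text \<open>By \<open>aimed\<close>, the leg is an initial piece of the segment from the current
  place to a point of the target line, so convexity of the zone applies.\<close>

lemma leg_in_zone:
  assumes "X k \<in> \<Omega>" "place u n k \<in> zone k" "0 \<le> r" "r \<le> \<rho> (trail u (time u n))"
  shows "place u n k + r *\<^sub>R heading u k n \<in> zone k"
proof -
  obtain x s where x: "x \<in> {0..l}" "s \<ge> \<rho> (trail u (time u n))"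
    "(x, 0) = place u n k + s *\<^sub>R heading u k n"
    using aim[of "trail u (time u n)" "place u n" k] by (auto simp: aimed_def heading_def)
  show ?thesis
  proof (cases "s = 0")
    case True
    then have "r = 0" using x(2) assms by simp
    then show ?thesis using assms by simp
  next
    case False
    then have s: "s > 0" using x assms by simp
    define \<mu> where "\<mu> = r / s"
    have "0 \<le> \<mu>" "\<mu> \<le> 1" using s x assms by (auto simp: \<mu>_def)
    then have "(1 - \<mu>) *\<^sub>R place u n k + \<mu> *\<^sub>R (x, 0) \<in> zone k"
      using zone[OF assms(1)] assms(2) x(1) by (intro convexD) auto
    also have "(1 - \<mu>) *\<^sub>R place u n k + \<mu> *\<^sub>R (x, 0) = place u n k + r *\<^sub>R heading u k n"
      unfolding x(3) using s by (simp add: \<mu>_def algebra_simps)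
    finally show ?thesis .
  qed
qed

lemma place_in_zone:
  assumes "X k \<in> \<Omega>"
  shows "place u n k \<in> zone k"
proof (induction n)
  case 0
  then show ?case using zone[OF assms] by simp
next
  case (Suc n)
  then show ?case
    using leg_in_zone[OF assms Suc, of "\<rho> (trail u (time u n))"] \<rho> vP
    unfolding place_Suc by (simp add: time_Suc)
qed

lemma position_chase_in_zone:
  assumes "X k \<in> \<Omega>" "0 \<le> t" "t < time u m"
  shows "position vP (X k) (chase u k) t \<in> zone k"
proof -
  obtain n where n: "time u n \<le> t" "t < time u (Suc n)" using interval_exists assms by blast
  then have "vP * (t - time u n) \<le> \<rho> (trail u (time u n))" using vP by (simp add: time_Suc field_simps)
  then show ?thesis
    using leg_in_zone[OF assms(1) place_in_zone[OF assms(1)], of "vP * (t - time u n)" u n]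
      position_chase[of u n t k] n vP by simp
qed

lemma position_chase_limit:
  assumes "bdd_above (range (time u))"
  shows "(\<lambda>n. place u n k) \<longlonglongrightarrow> position vP (X k) (chase u k) (SUP n. time u n)"
proof -
  let ?\<tau> = "SUP n. time u n"
  have "?\<tau> \<ge> 0" using cSUP_upper2[OF assms, of 0 0] by simp
  have "continuous_on {0..} (position vP (X k) (chase u k))"
    using chase_measurable norm_chase vP by (intro continuous_on_position) auto
  then have "(\<lambda>n. position vP (X k) (chase u k) (time u n)) \<longlonglongrightarrow> position vP (X k) (chase u k) ?\<tau>"
    by (rule continuous_on_tendsto_compose[OF _ tendsto_time[OF assms]])
      (use \<open>?\<tau> \<ge> 0\<close> time_nonneg in auto)
  then show ?thesis by (simp add: position_chase_time)
qed

lemma stay_in_controls: "x \<in> \<Omega> \<Longrightarrow> stay \<Omega> vP x \<in> controls \<Omega> vP x"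
  using game_domain_controls_nonempty[OF dom vP, of x] unfolding stay_def by (rule some_in_eq[THEN iffD2])

lemma limit_position_in_domain:
  assumes "X k \<in> \<Omega>" "bdd_above (range (time u))"
  shows "position vP (X k) (chase u k) (SUP n. time u n) \<in> \<Omega>"
  using closed_sequentially[OF zone(3)[OF assms(1)] place_in_zone[OF assms(1)] position_chase_limit[OF assms(2)]]
    zone(1)[OF assms(1)] by blast

lemma pursuit_in_controls:
  assumes X: "X k \<in> \<Omega>"
  shows "pursuit u k \<in> controls \<Omega> vP (X k)"
proof (cases "bdd_above (range (time u))")
  case True
  define \<tau> where "\<tau> = (SUP n. time u n)"
  have \<tau>: "\<tau> \<ge> 0" unfolding \<tau>_def using cSUP_upper2[OF True, of 0 0] by simp
  have end_pos: "position vP (X k) (chase u k) \<tau> \<in> \<Omega>"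
    unfolding \<tau>_def by (rule limit_position_in_domain[OF X True])
  have "position vP (X k) (chase u k) t \<in> \<Omega>" if t: "0 \<le> t" "t \<le> \<tau>" for t
  proof (cases "t = \<tau>")
    case False
    then obtain m where "t < time u m" using t less_cSUP_iff[OF _ True, of t] unfolding \<tau>_def by auto
    then show ?thesis using position_chase_in_zone[OF X] t zone(1)[OF X] by blast
  qed (use end_pos in simp)
  then have "then_control \<tau> (chase u k) (stay \<Omega> vP (position vP (X k) (chase u k) \<tau>)) \<in> controls \<Omega> vP (X k)"
    using chase_measurable norm_chase \<tau> stay_in_controls[OF end_pos] by (intro then_control_in_controls) auto
  then show ?thesis using True by (simp add: pursuit_def \<tau>_def Let_def)
next
  case False
  have "position vP (X k) (chase u k) t \<in> \<Omega>" if "t \<ge> 0" for t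
  proof -
    obtain m where "t < time u m" using False by (auto simp: bdd_above_def not_le)
    then show ?thesis using position_chase_in_zone[OF X] that zone(1)[OF X] by blast
  qed
  then show ?thesis
    using False chase_measurable norm_chase by (auto simp: pursuit_def controls_def)
qed

lemma position_pursuit:
  assumes X: "X k \<in> \<Omega>" and bdd: "bdd_above (range (time u))"
  shows "position vP (X k) (pursuit u k) (SUP n. time u n) = position vP (X k) (chase u k) (SUP n. time u n)"
proof -
  have "(SUP n. time u n) \<ge> 0" using cSUP_upper2[OF bdd, of 0 0] by simp
  then show ?thesis
    using position_then_control[OF chase_measurable norm_chase
        controlsD(1,2)[OF stay_in_controls[OF limit_position_in_domain[OF X bdd]]]] bdd
    by (simp add: pursuit_def Let_def)
qed

section \<open>Causality of the strategy\<close>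

lemma sampled_cong:
  assumes "\<And>s. 0 \<le> s \<Longrightarrow> s \<le> t \<Longrightarrow> trail u s = trail u' s" "time u n \<le> t"
  shows "time u' n = time u n \<and> place u' n = place u n"
  using assms(2)
proof (induction n)
  case (Suc n)
  then have n: "time u n \<le> t" using monoD[OF mono_time, of n "Suc n" u] by linarith
  with Suc.IH have IH: "time u' n = time u n" "place u' n = place u n" by auto
  \<comment> \<open>A step uses the evader's position only at its initial time, which belongs to the
    common past.\<close>
  then have "trail u' (time u' n) = trail u (time u n)" using assms(1) n time_nonneg by simp
  then show ?case using IH by (auto simp: time_Suc place_Suc heading_def)
qed simp

lemma pursuit_eq_chase:
  assumes "t < time u n"
  shows "pursuit u k t = chase u k t"
proof (cases "bdd_above (range (time u))")
  case True
  then have "t < (SUP n. time u n)" using assms cSUP_upper[OF _ True, of n] by simp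
  then show ?thesis by (simp add: pursuit_def then_control_def Let_def)
qed (simp add: pursuit_def)

lemma pursuit_cong:
  assumes same: "\<And>s. 0 \<le> s \<Longrightarrow> s \<le> t \<Longrightarrow> trail u s = trail u' s" and s: "0 \<le> s" "s \<le> t"
  shows "pursuit u k s = pursuit u' k s"
proof (cases "\<exists>m. s < time u m")
  case True
  then obtain n where n: "time u n \<le> s" "s < time u (Suc n)" using interval_exists s by blast
  have eq: "time u' n = time u n" "place u' n = place u n"
    using sampled_cong[of t u u' n] same n s by auto
  have p: "trail u' (time u n) = trail u (time u n)" using same[of "time u n"] n s time_nonneg by simp
  have eq': "time u' (Suc n) = time u (Suc n)" "heading u' k n = heading u k n"
    using eq p by (simp_all add: time_Suc heading_def)
  show ?thesis
    using n eq eq' switched_eq[OF mono_time, of u n s] switched_eq[OF mono_time, of u' n s]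
      pursuit_eq_chase[of s u "Suc n"] pursuit_eq_chase[of s u' "Suc n"] by (simp add: chase_def)
next
  case False
  \<comment> \<open>All sampling times are at most \<open>s\<close>, so the entire sampling
    sequences agree, and with them the accumulation time and the continuation after it.\<close>
  then have le: "time u n \<le> t" for n using s by (metis not_less order_trans)
  have eq: "time u' = time u" "place u' = place u" using sampled_cong[of t u u'] same le by auto
  moreover have "trail u' (time u n) = trail u (time u n)" for n using same le time_nonneg by simp
  ultimately have "heading u' = heading u" by (intro ext) (simp add: heading_def)
  with eq have "chase u' = chase u" by (intro ext) (simp add: chase_def)
  with eq show ?thesis by (simp add: pursuit_def)
qed

text \<open>Evader controls that agree almost everywhere have the same trajectory, so the pursuers'
  answers agree even at every instant.\<close>

lemma nonanticipative_pursuit: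
  assumes "\<And>k. k \<in> K \<Longrightarrow> X k \<in> \<Omega>"
  shows "nonanticipative \<Omega> vP vE X K y pursuit"
  unfolding nonanticipative_def
proof (intro conjI ballI allI impI)
  show "pursuit u k \<in> controls \<Omega> vP (X k)" if "k \<in> K" for u k
    using that assms by (intro pursuit_in_controls)
next
  fix u u' :: "real \<Rightarrow> plane" and t k
  assume "AE s in lebesgue_on {0..t}. u s = u' s"
  then have AE: "AE s in lebesgue. s \<in> {0..t} \<longrightarrow> u s = u' s" by (simp add: AE_restrict_space_iff)
  have "trail u s = trail u' s" if "0 \<le> s" "s \<le> t" for s
  proof (rule position_cong_AE)
    have "AE r in lebesgue. r \<in> {0..s} \<longrightarrow> u r = u' r" using AE by eventually_elim (use that in auto)
    then show "AE r in lebesgue_on {0..s}. u r = u' r" by (simp add: AE_restrict_space_iff)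
  qed
  then show "AE s in lebesgue_on {0..t}. pursuit u k s = pursuit u' k s"
    by (intro AE_I2) (auto intro: pursuit_cong)
qed

end

text \<open>Membership in the evader's region would give a play against the sampled strategy that
  the evader wins at some time \<open>t\<close>. The guard is renewed at every sampling time, and
  the steps are too short for the evader to arrive within one of them, so the sampling times
  accumulate no later than \<open>t\<close>. They can accumulate only when the evader is on the
  line, and there the limit of the guarding inequalities puts a pursuer at the evader's
  position.\<close>

lemma not_evader_region_if_guarded:
  assumes dom: "game_domain \<Omega> l" and v: "0 < vE" "vE < vP"
    and X: "X i \<in> \<Omega>" "X j \<in> \<Omega>" and guard: "guarded (vE / vP) l y (X i) (X j)"
  shows "y \<notin> evader_region \<Omega> vP vE X {i, j}"
proof
  assume y: "y \<in> evader_region \<Omega> vP vE X {i, j}"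
  define \<alpha> where "\<alpha> = vE / vP"
  have \<alpha>: "0 < \<alpha>" "\<alpha> < 1" "\<alpha> * vP = vE" using v by (auto simp: \<alpha>_def)
  have l: "l > 0" using dom by (simp add: game_domain_def)
  obtain c where c: "c > 0" "c \<le> 1 / (4 * \<alpha>)"
    and step: "\<And>y P Q \<rho>. \<rho> = min (c * \<bar>snd y\<bar>) (l / 2) \<Longrightarrow> \<exists>\<delta>. (\<forall>R. aimed l \<rho> R (\<delta> R)) \<and>
       (snd y < 0 \<longrightarrow> guarded \<alpha> l y P Q \<longrightarrow>
         (\<forall>y'. dist y y' \<le> \<alpha> * \<rho> \<longrightarrow> guarded \<alpha> l y' (P + \<rho> *\<^sub>R \<delta> P) (Q + \<rho> *\<^sub>R \<delta> Q)))"
    using guarded_step[OF \<alpha>(1,2) l] by blast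
  define \<rho> where "\<rho> z = min (c * \<bar>snd z\<bar>) (l / 2)" for z :: plane
  have \<rho>0: "\<rho> z \<ge> 0" for z using c l by (simp add: \<rho>_def)
  have "\<forall>z P Q. \<exists>\<delta>. (\<forall>R. aimed l (\<rho> z) R (\<delta> R)) \<and>
       (snd z < 0 \<longrightarrow> guarded \<alpha> l z P Q \<longrightarrow>
         (\<forall>y'. dist z y' \<le> \<alpha> * \<rho> z \<longrightarrow> guarded \<alpha> l y' (P + \<rho> z *\<^sub>R \<delta> P) (Q + \<rho> z *\<^sub>R \<delta> Q)))"
    using step \<rho>_def by blast
  then obtain \<delta> where \<delta>: "\<And>z P Q R. aimed l (\<rho> z) R (\<delta> z P Q R)"
    "\<And>z P Q y'. snd z < 0 \<Longrightarrow> guarded \<alpha> l z P Q \<Longrightarrow> dist z y' \<le> \<alpha> * \<rho> z \<Longrightarrow>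
       guarded \<alpha> l y' (P + \<rho> z *\<^sub>R \<delta> z P Q P) (Q + \<rho> z *\<^sub>R \<delta> z P Q Q)"
    by metis
  \<comment> \<open>The choice is made jointly for the two guarding positions \<open>Z i\<close> and
    \<open>Z j\<close>; since it is aimed from every point, the locale assumption holds for every
    index \<open>k\<close>.\<close>
  define D where "D z Z k = \<delta> z (Z i) (Z j) (Z k)" for z and Z :: "nat \<Rightarrow> plane" and k
  have D_apply: "D z Z k = \<delta> z (Z i) (Z j) (Z k)" for z Z k by (simp add: D_def)
  have tendsto_\<rho>: "(\<lambda>n. \<rho> (f n)) \<longlonglongrightarrow> \<rho> z" if "f \<longlonglongrightarrow> z" for f z
    unfolding \<rho>_def by (intro tendsto_intros that)
  interpret sampled_pursuit \<Omega> l vP vE X y \<rho> D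
    by unfold_locales (use dom v \<rho>0 \<delta>(1) in \<open>auto simp: D_def\<close>)
  have "nonanticipative \<Omega> vP vE X {i, j} y pursuit"
    using X by (intro nonanticipative_pursuit) auto
  then obtain u where u: "u \<in> controls \<Omega> vE y"
    and win: "evader_wins \<Omega> {i, j} (trail u) (\<lambda>k. position vP (X k) (pursuit u k))"
    using y unfolding evader_region_def play_def by blast
  then obtain t where t: "t \<ge> 0" "trail u t \<in> target_region \<Omega>"
    and "\<forall>s\<in>{0..<t}. trail u s \<in> play_region \<Omega>"
    and "\<forall>s\<in>{0..t}. \<forall>k\<in>{i, j}. trail u s \<noteq> position vP (X k) (pursuit u k) s"
    unfolding evader_wins_def by blast
  then have before: "\<And>s. 0 \<le> s \<Longrightarrow> s < t \<Longrightarrow> trail u s \<in> play_region \<Omega>"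
    and free: "\<And>s k. 0 \<le> s \<Longrightarrow> s \<le> t \<Longrightarrow> k \<in> {i, j} \<Longrightarrow> trail u s \<noteq> position vP (X k) (pursuit u k) s"
    by auto
  have "y \<in> play_region \<Omega>" using y by (simp add: evader_region_def)
  then have "t \<noteq> 0" using t by (auto simp: play_region_def)
  with t have "t > 0" by simp
  have lip: "dist (trail u r) (trail u s) \<le> vE * (s - r)" if "0 \<le> r" "r \<le> s" for r s
    using position_lipschitz[OF controlsD(1,2)[OF u] that] v by simp
  have inv: "time u n < t \<and> guarded \<alpha> l (trail u (time u n)) (place u n i) (place u n j)" for n
  proof (induction n)
    case 0
    then show ?case using \<open>t > 0\<close> guard by (simp add: \<alpha>_def)
  next
    case (Suc n)
    define z where "z = trail u (time u n)"
    have z: "snd z < 0" using before[OF time_nonneg] Suc by (auto simp: z_def play_region_eq)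
    have heading: "heading u k n = \<delta> z (place u n i) (place u n j) (place u n k)" for k
      unfolding heading_def z_def by (rule D_apply)
    have dt: "vE * (time u (Suc n) - time u n) = \<alpha> * \<rho> z"
      using v by (simp add: time_Suc z_def \<alpha>_def)
    have le: "time u n \<le> time u (Suc n)" by (rule monoD[OF mono_time]) simp
    \<comment> \<open>Within one step the evader covers at most \<open>\<alpha> * \<rho> z\<close>,
      and \<open>c \<le> 1 / (4 * \<alpha>)\<close> makes this at most a quarter of its distance
      from the axis.\<close>
    have "time u (Suc n) < t"
    proof (rule ccontr)
      assume late: "\<not> time u (Suc n) < t"
      have "dist z (trail u t) \<le> vE * (t - time u n)"
        using lip[of "time u n" t] Suc time_nonneg by (simp add: z_def)
      also have "\<dots> \<le> vE * (time u (Suc n) - time u n)"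
        using late v by (intro mult_left_mono) auto
      also have "vE * (time u (Suc n) - time u n) \<le> \<alpha> * (c * \<bar>snd z\<bar>)"
        unfolding dt using \<alpha> by (intro mult_left_mono) (auto simp: \<rho>_def)
      also have "\<dots> \<le> \<bar>snd z\<bar> / 4"
        using mult_right_mono[OF mult_left_mono[OF c(2), of \<alpha>], of "\<bar>snd z\<bar>"] \<alpha> by simp
      finally have "dist (snd z) (snd (trail u t)) \<le> \<bar>snd z\<bar> / 4" using dist_snd_le order_trans by blast
      then show False using z t(2) by (auto simp: target_region_def dist_real_def)
    qed
    moreover have "dist z (trail u (time u (Suc n))) \<le> \<alpha> * \<rho> z"
      using lip[OF time_nonneg le] by (simp add: dt z_def)
    then have "guarded \<alpha> l (trail u (time u (Suc n))) (place u (Suc n) i) (place u (Suc n) j)"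
      using \<delta>(2)[OF z] Suc v unfolding place_Suc heading by (simp add: time_Suc z_def)
    ultimately show ?case by simp
  qed
  then have bdd: "bdd_above (range (time u))" by (intro bdd_aboveI[of _ t]) (auto simp: less_imp_le)
  define \<tau> where "\<tau> = (SUP n. time u n)"
  have lim: "time u \<longlonglongrightarrow> \<tau>" unfolding \<tau>_def by (rule tendsto_time[OF bdd])
  have \<tau>: "0 \<le> \<tau>" "\<tau> \<le> t"
    using LIMSEQ_le_const[OF lim, of 0] LIMSEQ_le_const2[OF lim, of t] time_nonneg inv
    by (auto simp: less_imp_le)
  have "continuous_on {0..} (trail u)"
    using controlsD[OF u] v by (intro continuous_on_position) auto
  then have lim_trail: "(\<lambda>n. trail u (time u n)) \<longlonglongrightarrow> trail u \<tau>"
    by (rule continuous_on_tendsto_compose[OF _ lim]) (use \<tau> time_nonneg in auto)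
  \<comment> \<open>Step lengths are \<open>vP\<close> times the increments of a convergent sequence
    and so tend to zero; \<rho> vanishes only on the axis.\<close>
  have "\<rho> (trail u \<tau>) = 0"
  proof (rule LIMSEQ_unique)
    show "(\<lambda>n. \<rho> (trail u (time u n))) \<longlonglongrightarrow> \<rho> (trail u \<tau>)"
      by (rule tendsto_\<rho>[OF lim_trail])
    have "(\<lambda>n. vP * (time u (Suc n) - time u n)) \<longlonglongrightarrow> vP * (\<tau> - \<tau>)"
      by (intro tendsto_intros lim LIMSEQ_Suc)
    then show "(\<lambda>n. \<rho> (trail u (time u n))) \<longlonglongrightarrow> 0" using v by (simp add: time_Suc)
  qed
  then have "snd (trail u \<tau>) = 0" using c l by (auto simp: \<rho>_def min_def split: if_splits)
  then have "\<tau> = t" using before[of \<tau>] \<tau> by (force simp: play_region_eq)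
  obtain x where x: "x \<in> {0..l}" "trail u \<tau> = (x, 0)"
  proof -
    have "trail u \<tau> \<in> target_line l"
      using t(2) \<open>\<tau> = t\<close> \<open>snd (trail u \<tau>) = 0\<close> dom by (auto simp: game_domain_def target_region_def)
    then show ?thesis using that by (auto simp: target_line_eq[OF l])
  qed
  \<comment> \<open>At every sampling time one of the two gaps is nonpositive, but which one may
    change with \<open>n\<close>; therefore the limit is taken of their minimum.\<close>
  define gap where "gap k n = \<alpha> * dist (x, 0) (place u n k) - dist (x, 0) (trail u (time u n))" for k n
  have "(\<lambda>n. gap k n) \<longlonglongrightarrow> \<alpha> * dist (x, 0) (position vP (X k) (chase u k) \<tau>) - dist (x, 0) (trail u \<tau>)" for k
    unfolding gap_def \<tau>_def by (intro tendsto_intros position_chase_limit bdd lim_trail[unfolded \<tau>_def])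
  then have "(\<lambda>n. min (gap i n) (gap j n)) \<longlonglongrightarrow>
      min (\<alpha> * dist (x, 0) (position vP (X i) (chase u i) \<tau>)) (\<alpha> * dist (x, 0) (position vP (X j) (chase u j) \<tau>))"
    unfolding x(2) by (intro tendsto_min) simp_all
  moreover have "min (gap i n) (gap j n) \<le> 0" for n
  proof -
    have "gap i n \<le> 0 \<or> gap j n \<le> 0" using inv[of n] x(1) unfolding guarded_def gap_def by simp
    then show ?thesis by (simp add: min_le_iff_disj)
  qed
  ultimately have "min (\<alpha> * dist (x, 0) (position vP (X i) (chase u i) \<tau>))
      (\<alpha> * dist (x, 0) (position vP (X j) (chase u j) \<tau>)) \<le> 0"
    by (intro LIMSEQ_le_const2) auto
  then obtain k where k: "k \<in> {i, j}" "\<alpha> * dist (x, 0) (position vP (X k) (chase u k) \<tau>) \<le> 0"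
    by (auto simp: min_def split: if_splits)
  then have "position vP (X k) (chase u k) \<tau> = trail u \<tau>"
    using \<alpha> x by (simp add: mult_le_0_iff)
  moreover have "X k \<in> \<Omega>" using k X by auto
  ultimately show False
    using free[of \<tau> k] \<tau> k(1) position_pursuit[OF _ bdd, of k] by (simp add: \<tau>_def)
qed

section \<open>Two pursuers suffice\<close>

text \<open>In the plane the inequality describes the interior of an Apollonius circle or the empty
  set, and the trace on the target line is an interval. Analytically, \<open>f\<close> is concave
  along the line because \<alpha> is less than 1, so it is positive between two points at which it
  is positive.\<close>

lemma convex_dominance_region:
  fixes y z :: plane
  assumes "0 < \<alpha>" "\<alpha> < 1"
  shows "convex {x \<in> {0..l}. dist (x, 0) y < \<alpha> * dist (x, 0) z}"
proof (rule convexI)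
  fix a b :: real and m n :: real
  assume a: "a \<in> {x \<in> {0..l}. dist (x, 0) y < \<alpha> * dist (x, 0) z}"
    and b: "b \<in> {x \<in> {0..l}. dist (x, 0) y < \<alpha> * dist (x, 0) z}"
    and mn: "0 \<le> m" "0 \<le> n" "m + n = 1"
  define c where "c = m *\<^sub>R a + n *\<^sub>R b"
  have m: "m = 1 - n" using mn by simp
  have "c \<in> {0..l}" unfolding c_def
    using a b mn by (intro convexD) auto
  have c: "(1 - n) *\<^sub>R (a, 0) + n *\<^sub>R (b, 0) = (c, 0::real)" by (simp add: c_def m)
  have sq: "(dist (c, 0) w)\<^sup>2 = m * (dist (a, 0) w)\<^sup>2 + n * (dist (b, 0) w)\<^sup>2 - n * m * (dist (b, 0::real) (a, 0))\<^sup>2" for w :: plane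
    using dist_moved_point_sq[of w n "(a, 0)" "(b, 0)", unfolded c]
    by (simp add: m dist_commute)
  have pos: "(dist (x, 0) y)\<^sup>2 < \<alpha>\<^sup>2 * (dist (x, 0) z)\<^sup>2" if "dist (x, 0) y < \<alpha> * dist (x, 0) z" for x
    using power_strict_mono[OF that, of 2] by (simp add: power_mult_distrib)
  define f where "f x = \<alpha>\<^sup>2 * (dist (x, 0) z)\<^sup>2 - (dist (x, 0) y)\<^sup>2" for x
  have fab: "f a > 0" "f b > 0" using a b pos by (auto simp: f_def)
  have "f c = m * f a + n * f b + n * m * ((1 - \<alpha>\<^sup>2) * (dist (b, 0::real) (a, 0))\<^sup>2)"
    unfolding f_def sq[of y] sq[of z] by (simp add: algebra_simps)
  moreover have "0 \<le> n * m * ((1 - \<alpha>\<^sup>2) * (dist (b, 0::real) (a, 0))\<^sup>2)"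
    using mn assms by (simp add: power_le_one)
  moreover have "m * f a + n * f b > 0"
    using fab mn by (cases "m = 0") (auto intro: add_pos_nonneg)
  ultimately have "f c > 0" by linarith
  then have "(dist (c, 0) y)\<^sup>2 < (\<alpha> * dist (c, 0) z)\<^sup>2" by (simp add: f_def power_mult_distrib)
  then have "dist (c, 0) y < \<alpha> * dist (c, 0) z"
    by (rule power_less_imp_less_base) (use assms in simp)
  with \<open>c \<in> {0..l}\<close> show "m *\<^sub>R a + n *\<^sub>R b \<in> {x \<in> {0..l}. dist (x, 0) y < \<alpha> * dist (x, 0) z}"
    by (simp add: c_def)
qed

text \<open>\<open>S i\<close> consists of the points of the target line that the evader reaches
  strictly before pursuer \<open>i\<close>. If no pair guarded the line, these intervals would meet
  pairwise and, by Helly's theorem in dimension one, have a common point, to which the evader could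
  run. The case \<open>i = j\<close> is included and accounts for single pursuers.\<close>

lemma pair_suffices:
  assumes dom: "game_domain \<Omega> l" and v: "0 < vE" "vE < vP" and K: "finite K" "K \<noteq> {}"
    and X: "\<And>i. i \<in> K \<Longrightarrow> X i \<in> \<Omega>" and y: "y \<in> play_region \<Omega>"
    and no: "y \<notin> evader_region \<Omega> vP vE X K"
  obtains i j where "i \<in> K" "j \<in> K" "y \<notin> evader_region \<Omega> vP vE X {i, j}"
proof -
  define \<alpha> where "\<alpha> = vE / vP"
  have \<alpha>: "0 < \<alpha>" "\<alpha> < 1" using v by (auto simp: \<alpha>_def)
  define S where "S i = {x \<in> {0..l}. dist (x, 0) y < \<alpha> * dist (x, 0) (X i)}" for i
  have "\<exists>i\<in>K. \<exists>j\<in>K. guarded \<alpha> l y (X i) (X j)"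
  proof (rule ccontr)
    assume unguarded: "\<not> ?thesis"
    have meet: "S i \<inter> S j \<noteq> {}" if "i \<in> K" "j \<in> K" for i j
    proof -
      have "\<not> guarded \<alpha> l y (X i) (X j)" using unguarded that by blast
      then obtain x where "x \<in> S i" "x \<in> S j" unfolding guarded_def S_def by (auto simp: not_le)
      then show ?thesis by blast
    qed
    have "\<Inter>(S ` K) \<noteq> {}"
    \<comment> \<open>Helly's theorem requires at least two sets. Even several pursuers may yield
      only one, since equal sets are identified; that set is nonempty by \<open>meet\<close> with
      \<open>i = j\<close>.\<close>
    proof (cases "card (S ` K) \<ge> 2")
      case True
      show ?thesis
      proof (rule Helly)
        show "\<forall>s\<in>S ` K. convex s" unfolding S_def using convex_dominance_region[OF \<alpha>] by simp
        show "\<Inter>t \<noteq> {}" if t: "t \<subseteq> S ` K" "card t = DIM(real) + 1" for t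
        proof -
          have "card t = 2" using t(2) by simp
          then obtain a b where ab: "t = {a, b}" unfolding card_2_iff by blast
          then have "a \<in> S ` K" "b \<in> S ` K" using t(1) by simp_all
          then obtain i j where "i \<in> K" "j \<in> K" "a = S i" "b = S j" by (elim imageE)
          then show ?thesis using meet[of i j] ab by simp
        qed
      qed (use True in simp)
    next
      case False
      moreover have "card (S ` K) \<noteq> 0" using K by (simp add: card_eq_0_iff)
      ultimately have "card (S ` K) = 1" by linarith
      then obtain s where s: "S ` K = {s}" by (rule card_1_singletonE)
      obtain i where i: "i \<in> K" using K(2) by (metis ex_in_conv)
      then have "S i \<in> {s}" unfolding s[symmetric] by (rule imageI)
      then have "s \<noteq> {}" using meet[OF i i] by simp
      then show ?thesis unfolding s by simp
    qed
    then obtain x where "x \<in> \<Inter>(S ` K)" by (auto simp only: ex_in_conv[symmetric])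
    then have x: "\<And>i. i \<in> K \<Longrightarrow> x \<in> S i" by blast
    have "y \<in> evader_region \<Omega> vP vE X K"
    proof (rule evader_region_if_free_target[OF dom v K(1) y])
      show "x \<in> {0..l}" using x K by (auto simp: S_def)
      show "vP * dist (x, 0) y < vE * dist (x, 0) (X i)" if "i \<in> K" for i
      proof -
        have "dist (x, 0) y < vE / vP * dist (x, 0) (X i)" using x[OF that] by (simp add: S_def \<alpha>_def)
        then have "vP * dist (x, 0) y < vP * (vE / vP * dist (x, 0) (X i))" using v by (intro mult_strict_left_mono) auto
        then show ?thesis using v by simp
      qed
    qed
    with no show False by contradiction
  qed
  then obtain i j where ij: "i \<in> K" "j \<in> K" "guarded \<alpha> l y (X i) (X j)" by blast
  then have "y \<notin> evader_region \<Omega> vP vE X {i, j}"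
    unfolding \<alpha>_def using not_evader_region_if_guarded[OF dom v X X] by simp
  with ij that show ?thesis by blast
qed

section \<open>The constraint matrices\<close>

declare upt_Suc [simp del]

text \<open>The first \<open>m\<close> rows of the lexicographic list of pairs; the pairs in
  \<open>small_coalitions\<close> are the case \<open>m = Np\<close>, and varying \<open>m\<close>
  makes induction possible.\<close>

definition pairs_upto :: "nat \<Rightarrow> nat \<Rightarrow> nat set list" where
  "pairs_upto Np m = concat (map (\<lambda>i1. map (\<lambda>i2. {i1, i2}) [i1 + 1..<Np + 1]) [1..<m + 1])"

lemma pairs_upto_0 [simp]: "pairs_upto Np 0 = []"
  by (simp add: pairs_upto_def)

lemma pairs_upto_Suc:
  "pairs_upto Np (Suc m) = pairs_upto Np m @ map (\<lambda>i2. {Suc m, i2}) [Suc (Suc m)..<Suc Np]"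
  by (simp add: pairs_upto_def upt_Suc)

lemma small_coalitions_eq: "small_coalitions Np = map (\<lambda>i. {i}) [1..<Np + 1] @ pairs_upto Np Np"
  by (simp add: small_coalitions_def pairs_upto_def)

text \<open>The number of pairs whose smaller element is below \<open>a\<close>.\<close>

definition row_start :: "nat \<Rightarrow> nat \<Rightarrow> real" where
  "row_start Np a = (real a - 1) * (real Np - real a / 2)"

text \<open>There is no row 0; this is the value from which the recurrence yields 0 at row
  1.\<close>

lemma row_start_0 [simp]: "row_start Np 0 = - real Np"
  by (simp add: row_start_def)

lemma row_start_Suc: "row_start Np (Suc a) = row_start Np a + (real Np - real a)"
  by (simp add: row_start_def field_simps)

lemma row_start_mono:
  assumes "a \<le> b" "b \<le> Np"
  shows "row_start Np a \<le> row_start Np b"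
  using assms by (induction rule: dec_induct) (auto simp: row_start_Suc)

lemma length_pairs_upto: "m \<le> Np \<Longrightarrow> real (length (pairs_upto Np m)) = row_start Np (Suc m)"
  by (induction m) (auto simp: pairs_upto_Suc row_start_Suc)

text \<open>The column of a pair is the start of the row of its smaller element plus its offset in
  that row. List positions count from 0 and the columns of \<open>C_entry\<close> from 1, hence
  \<open>b + 1\<close>.\<close>

lemma pairs_upto_nth:
  assumes "m \<le> Np" "b < length (pairs_upto Np m)"
  shows "\<exists>i1 i2. 1 \<le> i1 \<and> i1 < i2 \<and> i2 \<le> Np \<and> pairs_upto Np m ! b = {i1, i2} \<and>
    real b + 1 = row_start Np i1 + (real i2 - real i1)"
  using assms
proof (induction m)
  case (Suc m)
  show ?case
  proof (cases "b < length (pairs_upto Np m)")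
    case True
    then have "pairs_upto Np (Suc m) ! b = pairs_upto Np m ! b" by (simp add: pairs_upto_Suc nth_append)
    then show ?thesis using Suc.IH[OF Suc_leD[OF Suc.prems(1)] True] by metis
  next
    case False
    define r where "r = b - length (pairs_upto Np m)"
    have r: "b = length (pairs_upto Np m) + r" "r < Np - Suc m"
      using False Suc.prems(2) unfolding r_def pairs_upto_Suc by simp_all
    have "pairs_upto Np (Suc m) ! b = {Suc m, Suc (Suc m) + r}"
      unfolding r(1) pairs_upto_Suc nth_append_length_plus using r(2) by simp
    moreover have "real b + 1 = row_start Np (Suc m) + (real (Suc (Suc m) + r) - real (Suc m))"
      using length_pairs_upto[of m Np] Suc.prems(1) unfolding r(1) by simp
    moreover have "Suc (Suc m) + r \<le> Np" using r by linarith
    ultimately show ?thesis by (intro exI[of _ "Suc m"] exI[of _ "Suc (Suc m) + r"]) simp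
  qed
qed simp

lemma in_set_pairs_upto:
  assumes "1 \<le> i1" "i1 < i2" "i2 \<le> Np"
  shows "{i1, i2} \<in> set (pairs_upto Np Np)"
proof -
  have "{i1, i2} \<in> (\<lambda>i2. {i1, i2}) ` {i1 + 1..<Np + 1}" by (rule imageI) (use assms in simp)
  moreover have "i1 \<in> {1..<Np + 1}" using assms by simp
  ultimately show ?thesis
    unfolding pairs_upto_def set_concat set_map image_image set_upt by (rule UN_I[rotated])
qed

lemma distinct_pairs_upto: "distinct (pairs_upto Np Np)"
  unfolding distinct_conv_nth
proof (intro allI impI notI)
  fix b b' assume b: "b < length (pairs_upto Np Np)" "b' < length (pairs_upto Np Np)" "b \<noteq> b'"
    and eq: "pairs_upto Np Np ! b = pairs_upto Np Np ! b'"
  obtain i1 i2 where 1: "i1 < i2" "pairs_upto Np Np ! b = {i1, i2}"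
    "real b + 1 = row_start Np i1 + (real i2 - real i1)" using pairs_upto_nth[OF order_refl b(1)] by blast
  obtain j1 j2 where 2: "j1 < j2" "pairs_upto Np Np ! b' = {j1, j2}"
    "real b' + 1 = row_start Np j1 + (real j2 - real j1)" using pairs_upto_nth[OF order_refl b(2)] by blast
  have "i1 = j1" "i2 = j2" using eq 1(1,2) 2(1,2) by (auto simp: doubleton_eq_iff)
  with 1 2 have "real b = real b'" by simp
  with b show False by simp
qed

text \<open>Row \<open>a\<close> occupies the columns from \<open>row_start Np a + 1\<close> to
  \<open>row_start Np (Suc a)\<close>, and monotonicity of the row starts makes these blocks
  disjoint.\<close>

lemma row_unique:
  assumes "row_start Np a + 1 \<le> x" "x \<le> row_start Np (Suc a)" "a \<le> Np"
    and "row_start Np b + 1 \<le> x" "x \<le> row_start Np (Suc b)" "b \<le> Np"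
  shows "a = b"
proof (rule ccontr)
  assume "a \<noteq> b"
  then consider "Suc a \<le> b" | "Suc b \<le> a" by linarith
  then show False
    using row_start_mono[of "Suc a" b Np] row_start_mono[of "Suc b" a Np] assms by cases linarith+
qed

text \<open>The first alternative in \<open>C_entry\<close> says that column \<open>j\<close>
  belongs to a pair \<open>{k, i}\<close> with \<open>k < i\<close>, the second that it lies in the
  row of pairs with smaller element \<open>i\<close>. So \<open>C_mat\<close> is the incidence
  matrix of pursuers and pairs.\<close>

lemma C_entry_eq:
  assumes i12: "1 \<le> i1" "i1 < i2" "i2 \<le> Np" and i: "1 \<le> i" "i \<le> Np"
    and j: "real j = row_start Np i1 + (real i2 - real i1)"
  shows "C_entry Np i j = (if i \<in> {i1, i2} then 1 else 0)"
proof -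
  have row: "row_start Np k + 1 \<le> row_start Np k + (real m - real k)"
    "row_start Np k + (real m - real k) \<le> row_start Np (Suc k)" if "k < m" "m \<le> Np" for k m
    using that by (auto simp: row_start_Suc)
  have "(\<exists>k\<in>{1..<i}. real j = real i - real k + (real k - 1) * (real Np - real k / 2)) \<longleftrightarrow> i = i2"
  proof
    assume "\<exists>k\<in>{1..<i}. real j = real i - real k + (real k - 1) * (real Np - real k / 2)"
    then obtain k where k: "k < i" "real j = row_start Np k + (real i - real k)"
      by (auto simp: row_start_def)
    then have "k = i1"
      using row[OF k(1) i(2)] row[OF i12(2,3)] i i12 j by (intro row_unique[of Np k "real j" i1]) auto
    then show "i = i2" using k j by simp
  qed (use i12 j in \<open>auto simp: row_start_def intro!: bexI[of _ i1]\<close>)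
  moreover have "(real i - 1) * (real Np - real i / 2) + 1 \<le> real j \<and> real j \<le> real i * (real Np - (real i + 1) / 2)
      \<longleftrightarrow> i = i1"
  proof -
    have start: "(real i - 1) * (real Np - real i / 2) = row_start Np i"
      "real i * (real Np - (real i + 1) / 2) = row_start Np (Suc i)"
      by (simp_all add: row_start_def algebra_simps)
    show ?thesis unfolding start
      using row[OF i12(2,3)] row_unique[of Np i "real j" i1] i i12 j by auto
  qed
  ultimately show ?thesis by (simp add: C_entry_def)
qed

section \<open>The list of small coalitions\<close>

lemma length_small_coalitions: "2 * length (small_coalitions Np) = Np * (Np + 1)"
proof -
  have "real (2 * length (small_coalitions Np)) = real (Np * (Np + 1))"
    by (simp add: small_coalitions_eq length_pairs_upto row_start_def field_simps)
  then show ?thesis by (rule of_nat_eq_iff[THEN iffD1])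
qed

lemma num_vars_eq: "num_vars Np Ne = length (small_coalitions Np) * Ne"
proof -
  have "Ne * Np * (Np + 1) = 2 * (length (small_coalitions Np) * Ne)"
    using length_small_coalitions[of Np] by (metis mult.assoc mult.commute)
  then show ?thesis by (simp add: num_vars_def)
qed

lemma length_pairs: "length (pairs_upto Np Np) = Np * (Np - 1) div 2"
proof -
  have "2 * length (pairs_upto Np Np) + 2 * Np = Np * (Np + 1)"
    using length_small_coalitions[of Np] by (simp add: small_coalitions_eq)
  then show ?thesis by (cases Np) auto
qed

lemma distinct_small_coalitions: "distinct (small_coalitions Np)"
proof -
  have "{i} \<notin> set (pairs_upto Np Np)" for i
  proof
    assume "{i} \<in> set (pairs_upto Np Np)"
    then obtain b where "b < length (pairs_upto Np Np)" "pairs_upto Np Np ! b = {i}"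
      by (auto simp: in_set_conv_nth)
    then show False using pairs_upto_nth[of Np Np b] by (auto simp: singleton_insert_inj_eq')
  qed
  then show ?thesis
    by (auto simp: small_coalitions_eq distinct_pairs_upto distinct_map inj_on_def)
qed

lemma small_coalition_nth:
  assumes "b < length (small_coalitions Np)"
  shows "small_coalitions Np ! b \<subseteq> {1..Np} \<and> small_coalitions Np ! b \<noteq> {}"
proof (cases "b < Np")
  case True
  then show ?thesis by (simp add: small_coalitions_eq nth_append)
next
  case False
  then have "b - Np < length (pairs_upto Np Np)" using assms by (simp add: small_coalitions_eq)
  then obtain i1 i2 where "1 \<le> i1" "i1 < i2" "i2 \<le> Np" "pairs_upto Np Np ! (b - Np) = {i1, i2}"
    using pairs_upto_nth[OF order_refl] by blast
  with False show ?thesis by (auto simp: small_coalitions_eq nth_append)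
qed

lemma in_small_coalitions:
  assumes "i \<in> {1..Np}" "j \<in> {1..Np}"
  shows "{i, j} \<in> set (small_coalitions Np)"
  using assms in_set_pairs_upto[of i j Np] in_set_pairs_upto[of j i Np]
  by (cases i j rule: linorder_cases) (auto simp: small_coalitions_eq insert_commute)

section \<open>Entries of the prior information vector and of the constraint matrices\<close>

lemma nth_concat_blocks:
  "k < length xs * n \<Longrightarrow>
    concat (map (\<lambda>x. map (f x) [1..<n + 1]) xs) ! k = f (xs ! (k div n)) (k mod n + 1)"
proof (induction xs arbitrary: k)
  case (Cons x xs)
  have n: "n > 0" using Cons.prems by (cases n) auto
  show ?case
  proof (cases "k < n")
    case True
    then show ?thesis by (simp add: nth_append)
  next
    case False
    then obtain k' where k': "k = n + k'" using le_Suc_ex not_less by blast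
    then show ?thesis using Cons n by (simp add: nth_append)
  qed
qed simp

lemma length_concat_blocks: "length (concat (map (\<lambda>x. map (f x) [1..<n + 1]) xs)) = length xs * n"
  by (induction xs) auto

lemma prior_information_nth:
  assumes "k < num_vars Np Ne"
  shows "prior_information \<Omega> vP vE Np Ne XP XE $ k =
    (if XE (k mod Ne + 1) \<in> evader_region \<Omega> vP vE XP (small_coalitions Np ! (k div Ne)) then 0 else 1)"
  using nth_concat_blocks[of k "small_coalitions Np" Ne
      "\<lambda>K j. if XE j \<in> evader_region \<Omega> vP vE XP K then 0 else (1 :: real)"] assms
  unfolding num_vars_eq by (simp add: prior_information_def vec_of_list_index)

lemma dim_prior_information: "dim_vec (prior_information \<Omega> vP vE Np Ne XP XE) = num_vars Np Ne"
  using length_concat_blocks[of "\<lambda>K j. if XE j \<in> evader_region \<Omega> vP vE XP K then 0 else (1 :: real)" Ne "small_coalitions Np"]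
  unfolding num_vars_eq prior_information_def by simp

lemma kronecker_dim [simp]:
  "dim_row (A \<otimes>\<^sub>K B) = dim_row A * dim_row B" "dim_col (A \<otimes>\<^sub>K B) = dim_col A * dim_col B"
  by (simp_all add: kronecker_def)

lemma ones_dim [simp]: "dim_row (ones m n) = m" "dim_col (ones m n) = n"
  by (simp_all add: ones_def)

lemma A2_mat_dim: "Ne \<ge> 1 \<Longrightarrow> A2_mat Np Ne \<in> carrier_mat Ne (num_vars Np Ne)"
  by (auto simp: A2_mat_def num_vars_eq)

lemma A2_mat_index:
  assumes "j < Ne" "k < num_vars Np Ne"
  shows "A2_mat Np Ne $$ (j, k) = (if k mod Ne = j then 1 else 0)"
  using assms by (auto simp: A2_mat_def kronecker_def ones_def num_vars_eq less_mult_imp_div_less)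

lemma C_mat_dim [simp]: "dim_row (C_mat Np) = Np" "dim_col (C_mat Np) = length (pairs_upto Np Np)"
  by (simp_all add: C_mat_def length_pairs)

lemma A3_mat_dim: "A3_mat Np Ne \<in> carrier_mat Np (num_vars Np Ne)"
  by (auto simp: A3_mat_def append_cols_def num_vars_eq small_coalitions_eq algebra_simps)

text \<open>Row \<open>i\<close> belongs to pursuer \<open>Suc i\<close>. The Kronecker product with
  a row of ones repeats the column of each coalition once per evader, so both parts together form
  the incidence matrix of pursuers and small coalitions with repeated columns.\<close>

lemma A3_mat_index:
  assumes i: "i < Np" and k: "k < num_vars Np Ne"
  shows "A3_mat Np Ne $$ (i, k) = (if Suc i \<in> small_coalitions Np ! (k div Ne) then 1 else 0)"
proof (cases "k < Np * Ne")
  case True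
  then have "k div Ne < Np" by (simp add: less_mult_imp_div_less)
  moreover have "Ne > 0" using True by (cases Ne) auto
  ultimately show ?thesis using True i
    by (auto simp: A3_mat_def append_cols_def kronecker_def ones_def small_coalitions_eq nth_append)
next
  case False
  \<comment> \<open>\<open>c\<close> is the column within the part for pairs and \<open>b\<close>
    below is the number of the pair, both counted from 0, whereas \<open>C_entry\<close> counts from
    1.\<close>
  then obtain c where c: "k = Np * Ne + c" using le_Suc_ex not_less by blast
  have Ne: "Ne > 0" using k by (cases Ne) (auto simp: num_vars_eq)
  define b where "b = c div Ne"
  have cl: "c < length (pairs_upto Np Np) * Ne"
    using k c by (simp add: num_vars_eq small_coalitions_eq algebra_simps)
  then have b: "b < length (pairs_upto Np Np)" unfolding b_def by (rule less_mult_imp_div_less)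
  obtain i1 i2 where i12: "1 \<le> i1" "i1 < i2" "i2 \<le> Np" "pairs_upto Np Np ! b = {i1, i2}"
    "real b + 1 = row_start Np i1 + (real i2 - real i1)" using pairs_upto_nth[OF order_refl b] by blast
  have "A3_mat Np Ne $$ (i, k) = (C_mat Np \<otimes>\<^sub>K ones 1 Ne) $$ (i, c)"
    using i cl c by (simp add: A3_mat_def append_cols_def)
  also have "\<dots> = C_mat Np $$ (i, b)"
    using i cl Ne by (simp add: kronecker_def ones_def b_def)
  also have "\<dots> = C_entry Np (Suc i) (Suc b)" using i b by (simp add: C_mat_def length_pairs)
  also have "\<dots> = (if Suc i \<in> {i1, i2} then 1 else 0)"
    using i i12 by (intro C_entry_eq) auto
  also have "{i1, i2} = small_coalitions Np ! (k div Ne)"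
    using i12 c Ne by (simp add: small_coalitions_eq nth_append b_def)
  finally show ?thesis .
qed

section \<open>Feasible points and matchings\<close>

text \<open>Decoding variables into edges turns statements about matchings into statements about
  columns. The 1 is added because evaders are counted from 1.\<close>

definition edge :: "nat \<Rightarrow> nat \<Rightarrow> nat \<Rightarrow> nat set \<times> nat" where
  "edge Np Ne k = (small_coalitions Np ! (k div Ne), k mod Ne + 1)"

lemma block_less: "k < num_vars Np Ne \<Longrightarrow> k div Ne < length (small_coalitions Np)"
  by (simp add: num_vars_eq less_mult_imp_div_less)

lemma inj_on_edge: "inj_on (edge Np Ne) {..<num_vars Np Ne}"
proof (rule inj_onI)
  fix k k' assume k: "k \<in> {..<num_vars Np Ne}" "k' \<in> {..<num_vars Np Ne}" and eq: "edge Np Ne k = edge Np Ne k'"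
  have "k div Ne = k' div Ne"
    using eq k block_less by (simp add: edge_def nth_eq_iff_index_eq[OF distinct_small_coalitions])
  moreover have "k mod Ne = k' mod Ne" using eq by (simp add: edge_def)
  ultimately show "k = k'" by (metis div_mult_mod_eq)
qed

lemma edge_column:
  assumes "b < length (small_coalitions Np)" "j \<in> {1..Ne}"
  shows "b * Ne + (j - 1) < num_vars Np Ne" "edge Np Ne (b * Ne + (j - 1)) = (small_coalitions Np ! b, j)"
proof -
  obtain j' where j: "j = Suc j'" "j' < Ne" using assms(2) by (cases j) auto
  have "b * Ne + j' < Suc b * Ne" using j by simp
  also have "\<dots> \<le> num_vars Np Ne" unfolding num_vars_eq using assms(1) by (intro mult_le_mono1) simp
  finally show "b * Ne + (j - 1) < num_vars Np Ne" using j by simp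
  show "edge Np Ne (b * Ne + (j - 1)) = (small_coalitions Np ! b, j)" using j by (simp add: edge_def)
qed

lemma edge_exists:
  assumes "K \<in> set (small_coalitions Np)" "j \<in> {1..Ne}"
  obtains k where "k < num_vars Np Ne" "edge Np Ne k = (K, j)"
proof -
  obtain b where b: "b < length (small_coalitions Np)" "small_coalitions Np ! b = K"
    using assms(1) by (auto simp: in_set_conv_nth)
  show ?thesis using that edge_column[OF b(1) assms(2)] b(2) by simp
qed

lemma assignment_eq:
  assumes "Ne \<ge> 1"
  shows "assignment Np Ne z = edge Np Ne ` {k. k < num_vars Np Ne \<and> z $ k = 1}"
proof (intro subset_antisym subsetI)
  fix x assume "x \<in> assignment Np Ne z"
  then obtain b j where x: "x = (small_coalitions Np ! b, j)" and b: "b < length (small_coalitions Np)"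
    and j: "j \<in> {1..Ne}" and z: "z $ (b * Ne + (j - 1)) = 1"
    by (auto simp: assignment_def)
  show "x \<in> edge Np Ne ` {k. k < num_vars Np Ne \<and> z $ k = 1}"
    unfolding x edge_column(2)[OF b j, symmetric] using edge_column(1)[OF b j] z by blast
next
  fix x assume "x \<in> edge Np Ne ` {k. k < num_vars Np Ne \<and> z $ k = 1}"
  then obtain k where k: "k < num_vars Np Ne" "z $ k = 1" "x = edge Np Ne k" by blast
  then have "x = (small_coalitions Np ! (k div Ne), k mod Ne + 1) \<and> k div Ne < length (small_coalitions Np)
      \<and> k mod Ne + 1 \<in> {1..Ne} \<and> z $ (k div Ne * Ne + (k mod Ne + 1 - 1)) = 1"
    using block_less[OF k(1)] Suc_leI[OF mod_less_divisor[of Ne k]] assms by (simp add: edge_def)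
  then show "x \<in> assignment Np Ne z" unfolding assignment_def by blast
qed

definition binary_vecs :: "nat \<Rightarrow> real Matrix.vec set" where
  "binary_vecs n = {z \<in> carrier_vec n. \<forall>i<n. z $ i \<in> {0, 1}}"

lemma binary_mult_mat_vec:
  fixes A :: "real mat"
  assumes z: "z \<in> binary_vecs n" and A: "A \<in> carrier_mat m n" and i: "i < m"
    and entry: "\<And>k. k < n \<Longrightarrow> A $$ (i, k) = (if R k then 1 else 0)"
  shows "(A *\<^sub>v z) $ i = real (card {k. k < n \<and> R k \<and> z $ k = 1})"
proof -
  have "(A *\<^sub>v z) $ i = (\<Sum>k<n. A $$ (i, k) * z $ k)"
  proof -
    have "dim_vec z = n" using z by (auto simp: binary_vecs_def)
    then show ?thesis using A i by (auto simp: scalar_prod_def atLeast0LessThan intro!: sum.cong)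
  qed
  also have "\<dots> = (\<Sum>k<n. if R k \<and> z $ k = 1 then 1 else 0)"
    using z entry by (intro sum.cong) (auto simp: binary_vecs_def)
  also have "\<dots> = (\<Sum>k\<in>{k \<in> {..<n}. R k \<and> z $ k = 1}. 1)"
    by (rule sum.inter_filter[symmetric]) simp
  finally show ?thesis by simp
qed

lemma binary_objective:
  assumes "z \<in> binary_vecs n"
  shows "ones_vec n \<bullet> z = real (card {k. k < n \<and> z $ k = 1})"
proof -
  have "ones_vec n \<bullet> z = (\<Sum>k<n. z $ k)"
  proof -
    have "dim_vec z = n" using assms by (auto simp: binary_vecs_def)
    then show ?thesis by (auto simp: scalar_prod_def ones_vec_def atLeast0LessThan intro!: sum.cong)
  qed
  also have "\<dots> = (\<Sum>k<n. if z $ k = 1 then 1 else 0)"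
    using assms by (intro sum.cong) (auto simp: binary_vecs_def)
  also have "\<dots> = (\<Sum>k\<in>{k \<in> {..<n}. z $ k = 1}. 1)"
    by (rule sum.inter_filter[symmetric]) simp
  finally show ?thesis by simp
qed

lemma objective_eq_card_assignment:
  assumes "z \<in> binary_vecs (num_vars Np Ne)" "Ne \<ge> 1"
  shows "ones_vec (num_vars Np Ne) \<bullet> z = real (card (assignment Np Ne z))"
proof -
  have "card (assignment Np Ne z) = card {k. k < num_vars Np Ne \<and> z $ k = 1}"
    unfolding assignment_eq[OF assms(2)]
    by (rule card_image, rule inj_on_subset[OF inj_on_edge]) auto
  then show ?thesis by (simp add: binary_objective[OF assms(1)])
qed

text \<open>With a 0-1 matrix and a binary vector, an entry of the product counts the selected
  columns marked in that row, so the bound 1 admits at most one of them.\<close>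

lemma mult_mat_vec_le_ones_iff:
  fixes A :: "real mat"
  assumes z: "z \<in> binary_vecs n" and A: "A \<in> carrier_mat m n"
    and entry: "\<And>i k. i < m \<Longrightarrow> k < n \<Longrightarrow> A $$ (i, k) = (if R i k then 1 else 0)"
  shows "A *\<^sub>v z \<le> ones_vec m \<longleftrightarrow>
    (\<forall>i<m. \<forall>k<n. \<forall>k'<n. R i k \<longrightarrow> R i k' \<longrightarrow> z $ k = 1 \<longrightarrow> z $ k' = 1 \<longrightarrow> k = k')"
proof -
  have "A *\<^sub>v z \<le> ones_vec m \<longleftrightarrow> (\<forall>i<m. (A *\<^sub>v z) $ i \<le> 1)"
    using A by (auto simp: less_eq_vec_def ones_vec_def)
  also have "\<dots> \<longleftrightarrow> (\<forall>i<m. card {k. k < n \<and> R i k \<and> z $ k = 1} \<le> Suc 0)"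
    using binary_mult_mat_vec[OF z A _ entry] by simp
  also have "\<dots> \<longleftrightarrow> (\<forall>i<m. \<forall>k<n. \<forall>k'<n. R i k \<longrightarrow> R i k' \<longrightarrow> z $ k = 1 \<longrightarrow> z $ k' = 1 \<longrightarrow> k = k')"
    by (subst card_le_Suc0_iff_eq) auto
  finally show ?thesis .
qed

text \<open>The constraints correspond one by one to the conditions on a matching:
  \<open>A1_mat\<close> to edges belonging to \<open>G\<close>, \<open>A2_mat\<close> to no evader
  being used twice, and \<open>A3_mat\<close> to disjoint coalitions.\<close>

lemma feasible_iff_matching:
  fixes XP XE :: "nat \<Rightarrow> plane" and \<Omega> vP vE Np Ne
  defines "G \<equiv> capture_edges \<Omega> vP vE Np Ne XP XE"
  assumes Ne: "Ne \<ge> 1" and z: "z \<in> binary_vecs (num_vars Np Ne)"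
  shows "z \<in> feasible Np Ne (prior_information \<Omega> vP vE Np Ne XP XE) \<longleftrightarrow> is_matching G (assignment Np Ne z)"
proof -
  let ?n = "num_vars Np Ne" and ?r = "prior_information \<Omega> vP vE Np Ne XP XE"
  define S where "S = {k. k < ?n \<and> z $ k = 1}"
  let ?K = "\<lambda>k. fst (edge Np Ne k)" and ?j = "\<lambda>k. snd (edge Np Ne k)"
  have K: "?K k \<subseteq> {1..Np}" "?K k \<noteq> {}" if "k \<in> S" for k
    using small_coalition_nth[OF block_less, of k Np Ne] that by (auto simp: edge_def S_def)
  have 1: "A1_mat Np Ne *\<^sub>v z \<le> ?r \<longleftrightarrow> edge Np Ne ` S \<subseteq> G"
  proof -
    have "A1_mat Np Ne *\<^sub>v z \<le> ?r \<longleftrightarrow> (\<forall>k<?n. z $ k \<le> ?r $ k)"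
      using z by (auto simp: A1_mat_def less_eq_vec_def dim_prior_information binary_vecs_def)
    also have "\<dots> \<longleftrightarrow> (\<forall>k\<in>S. ?r $ k = 1)"
    proof (intro iffI ballI allI impI)
      fix k assume "\<forall>k<?n. z $ k \<le> ?r $ k" "k \<in> S"
      then have "1 \<le> ?r $ k" "k < ?n" by (auto simp: S_def)
      then show "?r $ k = 1" by (auto simp: prior_information_nth split: if_splits)
    next
      fix k assume r: "\<forall>k\<in>S. ?r $ k = 1" and k: "k < ?n"
      have "0 \<le> ?r $ k" using k by (simp add: prior_information_nth)
      moreover have "z $ k = 0 \<or> z $ k = 1" using z k by (auto simp: binary_vecs_def)
      ultimately show "z $ k \<le> ?r $ k" using r k by (auto simp: S_def)
    qed
    also have "\<dots> \<longleftrightarrow> (\<forall>k\<in>S. edge Np Ne k \<in> G)"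
    proof (rule ball_cong[OF refl])
      fix k assume k: "k \<in> S"
      have "k mod Ne < Ne" using Ne by simp
      then show "?r $ k = 1 \<longleftrightarrow> edge Np Ne k \<in> G"
        using k K[OF k] by (auto simp: S_def prior_information_nth edge_def G_def capture_edges_def)
    qed
    finally show ?thesis by blast
  qed
  have 2: "A2_mat Np Ne *\<^sub>v z \<le> ones_vec Ne \<longleftrightarrow> (\<forall>k\<in>S. \<forall>k'\<in>S. ?j k = ?j k' \<longrightarrow> k = k')"
  proof -
    have "A2_mat Np Ne *\<^sub>v z \<le> ones_vec Ne \<longleftrightarrow>
      (\<forall>i<Ne. \<forall>k<?n. \<forall>k'<?n. k mod Ne = i \<longrightarrow> k' mod Ne = i \<longrightarrow> z $ k = 1 \<longrightarrow> z $ k' = 1 \<longrightarrow> k = k')"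
      using A2_mat_dim[OF Ne] A2_mat_index by (intro mult_mat_vec_le_ones_iff[OF z]) auto
    also have "\<dots> \<longleftrightarrow> (\<forall>k\<in>S. \<forall>k'\<in>S. ?j k = ?j k' \<longrightarrow> k = k')"
    proof
      assume L: "\<forall>i<Ne. \<forall>k<?n. \<forall>k'<?n. k mod Ne = i \<longrightarrow> k' mod Ne = i \<longrightarrow> z $ k = 1 \<longrightarrow> z $ k' = 1 \<longrightarrow> k = k'"
      show "\<forall>k\<in>S. \<forall>k'\<in>S. ?j k = ?j k' \<longrightarrow> k = k'"
      proof (intro ballI impI)
        fix k k' assume k: "k \<in> S" "k' \<in> S" "?j k = ?j k'"
        have "k mod Ne < Ne" using Ne by simp
        then show "k = k'" using L[rule_format, of "k mod Ne" k k'] k by (simp add: S_def edge_def)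
      qed
    qed (auto simp: S_def edge_def)
    finally show ?thesis .
  qed
  have 3: "A3_mat Np Ne *\<^sub>v z \<le> ones_vec Np \<longleftrightarrow> (\<forall>k\<in>S. \<forall>k'\<in>S. ?K k \<inter> ?K k' \<noteq> {} \<longrightarrow> k = k')"
  proof -
    have "A3_mat Np Ne *\<^sub>v z \<le> ones_vec Np \<longleftrightarrow>
      (\<forall>i<Np. \<forall>k<?n. \<forall>k'<?n. Suc i \<in> ?K k \<longrightarrow> Suc i \<in> ?K k' \<longrightarrow> z $ k = 1 \<longrightarrow> z $ k' = 1 \<longrightarrow> k = k')"
      using A3_mat_dim A3_mat_index by (intro mult_mat_vec_le_ones_iff[OF z]) (auto simp: edge_def)
    also have "\<dots> \<longleftrightarrow> (\<forall>k\<in>S. \<forall>k'\<in>S. ?K k \<inter> ?K k' \<noteq> {} \<longrightarrow> k = k')"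
    proof
      assume L: "\<forall>i<Np. \<forall>k<?n. \<forall>k'<?n. Suc i \<in> ?K k \<longrightarrow> Suc i \<in> ?K k' \<longrightarrow> z $ k = 1 \<longrightarrow> z $ k' = 1 \<longrightarrow> k = k'"
      show "\<forall>k\<in>S. \<forall>k'\<in>S. ?K k \<inter> ?K k' \<noteq> {} \<longrightarrow> k = k'"
      proof (intro ballI impI)
        fix k k' assume k: "k \<in> S" "k' \<in> S" "?K k \<inter> ?K k' \<noteq> {}"
        then obtain i where i: "i \<in> ?K k" "i \<in> ?K k'" by blast
        then have "1 \<le> i" "i \<le> Np" using K[OF k(1)] by auto
        then have "i - 1 < Np" "Suc (i - 1) = i" by auto
        with L[rule_format, of "i - 1" k k'] k i show "k = k'" by (simp add: S_def)
      qed
    next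
      assume R: "\<forall>k\<in>S. \<forall>k'\<in>S. ?K k \<inter> ?K k' \<noteq> {} \<longrightarrow> k = k'"
      show "\<forall>i<Np. \<forall>k<?n. \<forall>k'<?n. Suc i \<in> ?K k \<longrightarrow> Suc i \<in> ?K k' \<longrightarrow> z $ k = 1 \<longrightarrow> z $ k' = 1 \<longrightarrow> k = k'"
      proof (intro allI impI)
        fix i k k' assume "k < ?n" "k' < ?n" "Suc i \<in> ?K k" "Suc i \<in> ?K k'" "z $ k = 1" "z $ k' = 1"
        then show "k = k'" using R[rule_format, of k k'] by (auto simp: S_def)
      qed
    qed
    finally show ?thesis .
  qed
  have inj: "edge Np Ne k = edge Np Ne k' \<longleftrightarrow> k = k'" if "k \<in> S" "k' \<in> S" for k k'
    using that inj_onD[OF inj_on_edge, of Np Ne k k'] by (auto simp: S_def)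
  have "is_matching G (assignment Np Ne z) \<longleftrightarrow> edge Np Ne ` S \<subseteq> G \<and>
      (\<forall>k\<in>S. \<forall>k'\<in>S. k \<noteq> k' \<longrightarrow> ?K k \<noteq> ?K k' \<and> ?j k \<noteq> ?j k' \<and> ?K k \<inter> ?K k' = {})"
    unfolding is_matching_def assignment_eq[OF Ne] S_def[symmetric] case_prod_beta ball_simps
    using inj by (simp add: prod_eq_iff)
  also have "\<dots> \<longleftrightarrow> edge Np Ne ` S \<subseteq> G \<and> (\<forall>k\<in>S. \<forall>k'\<in>S. ?j k = ?j k' \<longrightarrow> k = k') \<and>
      (\<forall>k\<in>S. \<forall>k'\<in>S. ?K k \<inter> ?K k' \<noteq> {} \<longrightarrow> k = k')"
  proof -
    \<comment> \<open>Distinctness of the coalitions has no constraint of its own in the program; it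
      follows from disjointness because coalitions are nonempty.\<close>
    have "?K k \<noteq> ?K k'" if "k \<in> S" "?K k \<inter> ?K k' = {}" for k k' using K(2)[OF that(1)] that(2) by auto
    then have "(k \<noteq> k' \<longrightarrow> ?K k \<noteq> ?K k' \<and> ?j k \<noteq> ?j k' \<and> ?K k \<inter> ?K k' = {}) \<longleftrightarrow>
        (?j k = ?j k' \<longrightarrow> k = k') \<and> (?K k \<inter> ?K k' \<noteq> {} \<longrightarrow> k = k')" if "k \<in> S" for k k'
      using that by metis
    then have "(\<forall>k\<in>S. \<forall>k'\<in>S. k \<noteq> k' \<longrightarrow> ?K k \<noteq> ?K k' \<and> ?j k \<noteq> ?j k' \<and> ?K k \<inter> ?K k' = {}) \<longleftrightarrow>
        (\<forall>k\<in>S. \<forall>k'\<in>S. (?j k = ?j k' \<longrightarrow> k = k') \<and> (?K k \<inter> ?K k' \<noteq> {} \<longrightarrow> k = k'))"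
      by (intro ball_cong refl)
    then show ?thesis by (simp only: ball_conj_distrib)
  qed
  also have "\<dots> \<longleftrightarrow> z \<in> feasible Np Ne ?r"
    unfolding 1[symmetric] 2[symmetric] 3[symmetric] using z by (auto simp: feasible_def binary_vecs_def)
  finally show ?thesis by blast
qed

text \<open>Subsets of disjoint coalitions are disjoint, and being nonempty they are distinct. The
  evaders stay the same and are distinct, so no two edges are merged.\<close>

lemma matching_shrink:
  assumes M: "is_matching G M" and sub: "\<And>K j. (K, j) \<in> G \<Longrightarrow> g (K, j) \<subseteq> K \<and> g (K, j) \<noteq> {} \<and> (g (K, j), j) \<in> G"
  defines "M' \<equiv> (\<lambda>x. (g x, snd x)) ` M"
  shows "is_matching G M'" "card M' = card M"
proof -
  have MG: "M \<subseteq> G" using M by (simp add: is_matching_def)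
  have apart: "snd x \<noteq> snd x' \<and> fst x \<inter> fst x' = {}" if "x \<in> M" "x' \<in> M" "x \<noteq> x'" for x x'
    using M that unfolding is_matching_def case_prod_beta by (metis prod.collapse)
  have g: "g x \<subseteq> fst x" "g x \<noteq> {}" "(g x, snd x) \<in> G" if "x \<in> M" for x
    using sub[of "fst x" "snd x"] MG that by auto
  show "card M' = card M"
    unfolding M'_def by (rule card_image, rule inj_onI) (use apart in \<open>metis snd_conv\<close>)
  have "g x \<noteq> g x' \<and> snd x \<noteq> snd x' \<and> g x \<inter> g x' = {}" if "x \<in> M" "x' \<in> M" "x \<noteq> x'" for x x'
    using apart[OF that] g[OF that(1)] g[OF that(2)] by blast
  then show "is_matching G M'"
    using g(3) unfolding is_matching_def M'_def by fastforce
qed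

section \<open>The matching number as the optimum of the integer program\<close>

theorem theorem5:
  fixes \<Omega> :: "plane set" and l vP vE \<alpha> :: real
    and Np Ne :: nat and XP XE :: "nat \<Rightarrow> plane"
  defines "\<alpha> \<equiv> vE / vP"
    and "G \<equiv> capture_edges \<Omega> vP vE Np Ne XP XE"
    and "Z \<equiv> feasible Np Ne (prior_information \<Omega> vP vE Np Ne XP XE)"
    and "c \<equiv> ones_vec (num_vars Np Ne)"
  assumes "game_domain \<Omega> l"
    and "vP > 0" and "vE > 0" and "0 < \<alpha>" and "\<alpha> < 1"
    and "Np \<ge> 1" and "Ne \<ge> 1"
    and "\<And>i. i \<in> {1..Np} \<Longrightarrow> XP i \<in> \<Omega>"
    and "\<And>j. j \<in> {1..Ne} \<Longrightarrow> XE j \<in> play_region \<Omega>"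
    and "inj_on XP {1..Np}" and "inj_on XE {1..Ne}"
    and "\<And>i j. i \<in> {1..Np} \<Longrightarrow> j \<in> {1..Ne} \<Longrightarrow> XP i \<noteq> XE j"
    and "\<And>i i'. i \<in> {1..Np} \<Longrightarrow> i' \<in> {1..Np} \<Longrightarrow> i' \<noteq> i \<Longrightarrow> XP i \<in> target_region \<Omega> \<Longrightarrow>
           virtual_pursuer (XP i) \<noteq> XP i'"
  shows "real (matching_number G) = Max ((\<lambda>z. c \<bullet> z) ` Z) \<and>
    (\<exists>z. is_arg_max (\<lambda>z. c \<bullet> z) (\<lambda>z. z \<in> Z) z) \<and>
    (\<forall>z. is_arg_max (\<lambda>z. c \<bullet> z) (\<lambda>z. z \<in> Z) z \<longrightarrow>
       is_maximum_matching G (assignment Np Ne z))"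
proof -
  note dom = \<open>game_domain \<Omega> l\<close> and Ne = \<open>Ne \<ge> 1\<close>
  have v: "0 < vE" "vE < vP" using assms(6-9) by (auto simp: \<alpha>_def field_simps)
  \<comment> \<open>Every edge can be shrunk to one whose coalition has one or two members and is
    still joined to the same evader.\<close>
  have "\<exists>g. g \<subseteq> K \<and> g \<noteq> {} \<and> (g, j) \<in> G \<and> g \<in> set (small_coalitions Np)" if "(K, j) \<in> G" for K j
  proof -
    have K: "K \<subseteq> {1..Np}" "K \<noteq> {}" "j \<in> {1..Ne}" "XE j \<notin> evader_region \<Omega> vP vE XP K"
      using that by (auto simp: G_def capture_edges_def)
    have "XP i \<in> \<Omega>" if "i \<in> K" for i using that K(1) assms(12) by blast
    then obtain i i' where "i \<in> K" "i' \<in> K" "XE j \<notin> evader_region \<Omega> vP vE XP {i, i'}"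
      using pair_suffices[OF dom v finite_subset[OF K(1)] K(2) _ assms(13)[OF K(3)] K(4)] by auto
    moreover from this have "{i, i'} \<in> set (small_coalitions Np)"
      using K(1) by (intro in_small_coalitions) auto
    ultimately show ?thesis
      using K
      by (intro exI[of _ "{i, i'}"]) (auto simp: G_def capture_edges_def)
  qed
  then obtain g where g: "\<And>K j. (K, j) \<in> G \<Longrightarrow>
      g (K, j) \<subseteq> K \<and> g (K, j) \<noteq> {} \<and> (g (K, j), j) \<in> G \<and> g (K, j) \<in> set (small_coalitions Np)"
    by (metis (no_types, lifting) surj_pair split_conv)
  have Z: "Z = {z \<in> binary_vecs (num_vars Np Ne). is_matching G (assignment Np Ne z)}"
  proof -
    have "Z \<subseteq> binary_vecs (num_vars Np Ne)" by (auto simp: Z_def feasible_def binary_vecs_def)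
    then show ?thesis using feasible_iff_matching[OF Ne] unfolding Z_def G_def by blast
  qed
  have obj: "c \<bullet> z = real (card (assignment Np Ne z))" if "z \<in> Z" for z
    using objective_eq_card_assignment[OF _ Ne] that unfolding Z c_def by blast
  \<comment> \<open>Shrinking an arbitrary matching by \<open>g\<close> leaves only coalitions that
    have variables; the indicator vector of the result is then a feasible point with the same number
    of edges.\<close>
  have realise: "\<exists>z\<in>Z. card (assignment Np Ne z) = card M" if M: "is_matching G M" for M
  proof -
    define M' where "M' = (\<lambda>x. (g x, snd x)) ` M"
    have M': "is_matching G M'" "card M' = card M"
      unfolding M'_def using matching_shrink[OF M, of g] g by blast+
    define z where "z = Matrix.vec (num_vars Np Ne) (\<lambda>k. if edge Np Ne k \<in> M' then 1 else 0 :: real)"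
    have "z \<in> binary_vecs (num_vars Np Ne)" by (auto simp: z_def binary_vecs_def)
    moreover have "assignment Np Ne z = M'"
    proof -
      have "{k. k < num_vars Np Ne \<and> z $ k = 1} = {k. k < num_vars Np Ne \<and> edge Np Ne k \<in> M'}"
        by (auto simp: z_def split: if_splits)
      moreover have "x \<in> edge Np Ne ` {k. k < num_vars Np Ne}" if "x \<in> M'" for x
      proof -
        obtain y where y: "y \<in> M" "x = (g y, snd y)" using \<open>x \<in> M'\<close> unfolding M'_def by blast
        obtain K j where Kj: "y = (K, j)" by (rule prod.exhaust)
        have KG: "(K, j) \<in> G" using M y(1) unfolding Kj is_matching_def by blast
        then have "j \<in> {1..Ne}" by (simp add: G_def capture_edges_def)
        then obtain k where "k < num_vars Np Ne" "edge Np Ne k = (g (K, j), j)"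
          using edge_exists g[OF KG] by blast
        then show ?thesis using y(2) Kj by force
      qed
      ultimately show ?thesis unfolding assignment_eq[OF Ne] by blast
    qed
    ultimately have "z \<in> Z" "card (assignment Np Ne z) = card M" using M' by (simp_all add: Z)
    then show ?thesis by blast
  qed
  define N where "N = card ` {M. is_matching G M}"
  \<comment> \<open>The objective on the feasible set and the sizes of all matchings take the same
    values, so the two maxima agree, and finiteness of the first set follows from that of the
    second.\<close>
  have objective_values: "(\<lambda>z. c \<bullet> z) ` Z = real ` N"
  proof (intro subset_antisym subsetI)
    fix x assume "x \<in> (\<lambda>z. c \<bullet> z) ` Z"
    then obtain z where "z \<in> Z" "x = c \<bullet> z" by blast
    then have "is_matching G (assignment Np Ne z)" "x = real (card (assignment Np Ne z))"
      using obj[of z] unfolding Z by simp_all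
    then show "x \<in> real ` N" unfolding N_def by blast
  next
    fix x assume "x \<in> real ` N"
    then obtain M where M: "is_matching G M" "x = real (card M)" by (auto simp: N_def)
    obtain z where z: "z \<in> Z" "card (assignment Np Ne z) = card M" using realise[OF M(1)] by blast
    then have "x = c \<bullet> z" using M(2) obj[OF z(1)] by simp
    then show "x \<in> (\<lambda>z. c \<bullet> z) ` Z" using z(1) by (rule image_eqI)
  qed
  have "G \<subseteq> Pow {1..Np} \<times> {1..Ne}" by (auto simp: G_def capture_edges_def)
  then have "finite G" by (rule finite_subset) simp
  then have "finite {M. is_matching G M}"
    by (intro finite_subset[of "{M. is_matching G M}" "Pow G"]) (auto simp: is_matching_def)
  then have finN: "finite N" by (simp add: N_def)
  have "is_matching G {}" by (simp add: is_matching_def)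
  then have neN: "N \<noteq> {}" unfolding N_def by blast
  have number: "matching_number G = Max N" by (simp add: matching_number_def N_def)
  have max: "real (matching_number G) = Max ((\<lambda>z. c \<bullet> z) ` Z)"
    unfolding number objective_values by (rule mono_Max_commute[OF _ finN neN]) (simp add: mono_def)
  have fin: "finite ((\<lambda>z. c \<bullet> z) ` Z)" "(\<lambda>z. c \<bullet> z) ` Z \<noteq> {}"
    unfolding objective_values using finN neN by auto
  \<comment> \<open>\<open>is_arg_max\<close> only says that no feasible point is strictly better.
    As the maximum is attained and the reals are linearly ordered, this amounts to attaining the
    matching number.\<close>
  have arg_max: "is_arg_max (\<lambda>z. c \<bullet> z) (\<lambda>z. z \<in> Z) z \<longleftrightarrow> z \<in> Z \<and> c \<bullet> z = real (matching_number G)" for z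
  proof -
    have le: "c \<bullet> z \<le> real (matching_number G)" if "z \<in> Z" for z
      unfolding max using fin(1) that by (intro Max_ge) auto
    have "real (matching_number G) \<in> (\<lambda>z. c \<bullet> z) ` Z" unfolding max using fin by (rule Max_in)
    then obtain z' where z': "z' \<in> Z" "c \<bullet> z' = real (matching_number G)" by force
    show ?thesis
    proof
      assume "is_arg_max (\<lambda>z. c \<bullet> z) (\<lambda>z. z \<in> Z) z"
      then have z: "z \<in> Z" "\<not> c \<bullet> z' > c \<bullet> z" using z'(1) by (auto simp: is_arg_max_def)
      with le[OF z(1)] z'(2) show "z \<in> Z \<and> c \<bullet> z = real (matching_number G)" by simp
    next
      assume "z \<in> Z \<and> c \<bullet> z = real (matching_number G)"
      then show "is_arg_max (\<lambda>z. c \<bullet> z) (\<lambda>z. z \<in> Z) z" using le by (auto simp: is_arg_max_def not_less)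
    qed
  qed
  have "real (matching_number G) \<in> (\<lambda>z. c \<bullet> z) ` Z" unfolding max using fin by (rule Max_in)
  then have "\<exists>z. is_arg_max (\<lambda>z. c \<bullet> z) (\<lambda>z. z \<in> Z) z" unfolding arg_max by force
  moreover have "is_maximum_matching G (assignment Np Ne z)" if "is_arg_max (\<lambda>z. c \<bullet> z) (\<lambda>z. z \<in> Z) z" for z
  proof -
    have z: "z \<in> Z" "c \<bullet> z = real (matching_number G)" using that by (simp_all add: arg_max)
    then have "real (card (assignment Np Ne z)) = real (matching_number G)" using obj by simp
    then show ?thesis using z(1) by (simp add: is_maximum_matching_def Z)
  qed
  ultimately show ?thesis using max by blast
qed

end
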